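(* (i) Each equivalence class of block Jacobi matrices contains exactly one element of type 1, exactly one element of type 2, and exactly one element of type 3. (ii) Let $d\mu$ be a non-trivial, compactly supported, normalized $l\times l$ matrix-valued measure on $\mathbb{R}$, let $(\sigma_n)_{n\ge 0}$ be unitary $l\times l$ matrices with $\sigma_0=\mathbf 1$, let $p_n^R(x)=P_n^R(x)\langle\!\langle P_n^R,P_n^R\rangle\!\rangle_R^{-1/2}\sigma_n$ be the corresponding right orthonormal polynomials, and let $J$ be the block Jacobi matrix with blocks $J_{nm}=\langle\!\langle p_{n-1}^R,xp_{m-1}^R\rangle\!\rangle_R$, $n,m\ge 1$. Then $J$ is of type 2 if and only if $\sigma_n=\mathbf 1$ for all $n$.
   Context: Fix $l\ge 1$. $\mathcal M_l$ denotes the $l\times l$ complex matrices, $^\dagger$ the Hermitian adjoint, $\mathbf 1$ the identity matrix. For a matrix $A$, $A>0$ means $A$ is Hermitian and positive definite. A block Jacobi matrix with Jacobi parameters $(A_n,B_n)_{n\ge1}$, $A_n,B_n\in\mathcal M_l$, $B_n=B_n^\dagger$, $\det A_n\neq 0$, is the block tridiagonal matrix $J=(J_{nm})_{n,m\ge1}$ of $l\times l$ blocks with $J_{nn}=B_n$, $J_{n,n+1}=A_n$, $J_{n+1,n}=A_n^\dagger$, and all other blocks zero. Only bounded block Jacobi matrices are considered: $\sup_n(\|A_n\|+\|B_n\|)<\infty$. Two block Jacobi matrices $J,\tilde J$ are equivalent if there are unitaries $u_n\in\mathcal M_l$, $n\ge1$, with $u_1=\mathbf 1$ and $\tilde J_{nm}=u_n^\dagger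 J_{nm}u_m$ for all $n,m$ (i.e. $\tilde B_n=u_n^\dagger B_nu_n$, $\tilde A_n=u_n^\dagger A_nu_{n+1}$). $J$ is of type 1 if $A_n>0$ for all $n$; of type 2 if $A_1A_2\cdots A_n>0$ for all $n$; of type 3 if every $A_n$ is lower triangular with strictly positive diagonal elements. For a positive semi-definite $l\times l$ matrix-valued measure $d\mu$ on $\mathbb R$ with compact support, normalized by $\mu(\mathbb R)=\mathbf 1$, and matrix polynomials $f,g$ (coefficients in $\mathcal M_l$), set $\langle\!\langle f,g\rangle\!\rangle_R=\int f(x)^\dagger\,d\mu(x)\,g(x)$. The measure is non-trivial if $\operatorname{Tr}\langle\!\langle f,f\rangle\!\rangle_R>0$ for every non-zero matrix polynomial $f$. $P_n^R$ is the unique monic matrix polynomial of degree $n$ (leading coefficient $\mathbf 1$) with $\langle\!\langle P_n^R,f\rangle\!\rangle_R=0$ for all matrix polynomials $f$ of degree $<n$. *)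

theory Defs
  imports "HOL-Analysis.Analysis" "HOL-Computational_Algebra.Polynomial"
begin

section \<open>Complex square matrices\<close>

text \<open>
  The type \<open>complex^'l^'l\<close> stands for the ring of complex square matrices of size
  \<open>l = CARD('l)\<close>. Its product is \<open>**\<close> and its unit is \<open>mat 1\<close>; the overloaded \<open>*\<close> and \<open>1\<close> on
  this type are entrywise and are never used. The linear order on \<open>'l\<close> is only needed to
  speak of triangular matrices.
\<close>

definition hadjoint :: "complex^'n^'m \<Rightarrow> complex^'m^'n" where
  "hadjoint A = (\<chi> i j. cnj (A $ j $ i))"

definition hermitian :: "complex^'l^'l \<Rightarrow> bool" where
  "hermitian A \<longleftrightarrow> hadjoint A = A"

definition unitary :: "complex^'l^'l \<Rightarrow> bool" where
  "unitary U \<longleftrightarrow> hadjoint U ** U = mat 1 \<and> U ** hadjoint U = mat 1"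

definition cinner :: "complex^'l \<Rightarrow> complex^'l \<Rightarrow> complex" where
  "cinner v w = (\<Sum>i\<in>UNIV. cnj (v $ i) * w $ i)"

definition possemidef :: "complex^'l^'l \<Rightarrow> bool" where
  "possemidef A \<longleftrightarrow> hermitian A \<and> (\<forall>v. 0 \<le> Re (cinner v (A *v v)))"

definition posdef :: "complex^'l^'l \<Rightarrow> bool" where
  "posdef A \<longleftrightarrow> hermitian A \<and> (\<forall>v. v \<noteq> 0 \<longrightarrow> 0 < Re (cinner v (A *v v)))"

text \<open>The positive definite square root of a positive definite matrix, and its inverse.\<close>

definition pd_sqrt :: "complex^'l^'l \<Rightarrow> complex^'l^'l" where
  "pd_sqrt A = (THE S. posdef S \<and> S ** S = A)"

definition inv_sqrt :: "complex^'l^'l \<Rightarrow> complex^'l^'l" where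
  "inv_sqrt A = matrix_inv (pd_sqrt A)"


section \<open>Block Jacobi matrices\<close>

text \<open>
  All sequences are indexed from 0: \<open>A n\<close>, \<open>B n\<close>, \<open>J n m\<close>, \<open>u n\<close> below are
  $A_{n+1}$, $B_{n+1}$, $J_{n+1,m+1}$, $u_{n+1}$ in the usual numbering from 1.
\<close>

type_synonym 'l block_matrix = "nat \<Rightarrow> nat \<Rightarrow> complex^'l^'l"

definition jacobi_blocks ::
    "(nat \<Rightarrow> complex^'l^'l) \<Rightarrow> (nat \<Rightarrow> complex^'l^'l) \<Rightarrow> 'l block_matrix" where
  "jacobi_blocks A B n m =
     (if m = n then B n
      else if m = Suc n then A n
      else if n = Suc m then hadjoint (A m)
      else 0)"

text \<open>
  Boundedness is part of the definition. The norm is the Euclidean (Hilbert--Schmidt) norm of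
  \<open>complex^'l^'l\<close>, which is equivalent to the operator norm.
\<close>

definition block_jacobi :: "('l::finite) block_matrix set" where
  "block_jacobi = {J. \<exists>A B. J = jacobi_blocks A B
      \<and> (\<forall>n. hermitian (B n)) \<and> (\<forall>n. det (A n) \<noteq> 0)
      \<and> bdd_above (range (\<lambda>n. norm (A n) + norm (B n)))}"

definition block_jacobi_equiv :: "(('l::finite) block_matrix \<times> 'l block_matrix) set" where
  "block_jacobi_equiv = {(J, J'). J \<in> block_jacobi \<and> J' \<in> block_jacobi \<and>
     (\<exists>u. (\<forall>n. unitary (u n)) \<and> u 0 = mat 1 \<and>
          (\<forall>n m. J' n m = hadjoint (u n) ** J n m ** u m))}"

text \<open>The ordered product of the first \<open>n\<close> members of a sequence of matrices.\<close>

primrec mat_prod :: "(nat \<Rightarrow> complex^'l^'l) \<Rightarrow> nat \<Rightarrow> complex^'l^'l" where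
  "mat_prod A 0 = mat 1"
| "mat_prod A (Suc n) = mat_prod A n ** A n"

definition lower_triangular_pos :: "complex^('l::{finite,linorder})^('l::{finite,linorder}) \<Rightarrow> bool" where
  "lower_triangular_pos A \<longleftrightarrow>
     (\<forall>i j. i < j \<longrightarrow> A $ i $ j = 0) \<and> (\<forall>i. A $ i $ i \<in> \<real> \<and> 0 < Re (A $ i $ i))"

definition type1 :: "('l::finite) block_matrix \<Rightarrow> bool" where
  "type1 J \<longleftrightarrow> (\<forall>n. posdef (J n (Suc n)))"

definition type2 :: "('l::finite) block_matrix \<Rightarrow> bool" where
  "type2 J \<longleftrightarrow> (\<forall>n>0. posdef (mat_prod (\<lambda>k. J k (Suc k)) n))"

definition type3 :: "('l::{finite,linorder}) block_matrix \<Rightarrow> bool" where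
  "type3 J \<longleftrightarrow> (\<forall>n. lower_triangular_pos (J n (Suc n)))"


section \<open>Matrix-valued measures on the real line\<close>

text \<open>
  A matrix-valued measure is a set function, of which only the values on Borel sets matter.
\<close>

definition matrix_measure :: "(real set \<Rightarrow> complex^'l^'l) \<Rightarrow> bool" where
  "matrix_measure \<mu> \<longleftrightarrow>
     \<mu> {} = 0 \<and> (\<forall>E\<in>sets borel. possemidef (\<mu> E)) \<and>
     (\<forall>E :: nat \<Rightarrow> real set. range E \<subseteq> sets borel \<longrightarrow> disjoint_family E \<longrightarrow>
        (\<lambda>n. \<mu> (E n)) sums \<mu> (\<Union>n. E n))"

definition mm_support :: "(real set \<Rightarrow> complex^'l^'l) \<Rightarrow> real set" where
  "mm_support \<mu> = {x. \<forall>U. open U \<longrightarrow> x \<in> U \<longrightarrow> \<mu> U \<noteq> 0}"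

text \<open>
  For a vector \<open>v\<close>, \<open>quad_measure \<mu> v\<close> is the finite positive Borel measure
  $E \mapsto v^\dagger \mu(E) v$. By polarization every entry of \<open>\<mu>\<close> is a complex linear
  combination of four such measures (\<open>polarization\<close> below), and the integral against the complex
  measure $\mu_{ij}$ is the corresponding combination of Bochner integrals.
\<close>

definition quad_measure :: "(real set \<Rightarrow> complex^'l^'l) \<Rightarrow> complex^'l \<Rightarrow> real measure" where
  "quad_measure \<mu> v = measure_of UNIV (sets borel) (\<lambda>E. ennreal (Re (cinner v (\<mu> E *v v))))"

definition polar_vec :: "'l::finite \<Rightarrow> 'l \<Rightarrow> nat \<Rightarrow> complex^'l" where
  "polar_vec i j k = axis i 1 + \<i> ^ k *s axis j 1"

definition entry_integral ::
    "(real set \<Rightarrow> complex^'l^'l) \<Rightarrow> 'l \<Rightarrow> 'l \<Rightarrow> (real \<Rightarrow> complex) \<Rightarrow> complex" where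
  "entry_integral \<mu> i j h =
     (\<Sum>k<4. (- \<i>) ^ k * (LINT x|quad_measure \<mu> (polar_vec i j k). h x)) / 4"

text \<open>$\int f(x)^\dagger\, d\mu(x)\, g(x)$\<close>

definition mm_inner ::
    "(real set \<Rightarrow> complex^'l^'l) \<Rightarrow> (real \<Rightarrow> complex^'l^'l) \<Rightarrow> (real \<Rightarrow> complex^'l^'l)
      \<Rightarrow> complex^'l^'l" where
  "mm_inner \<mu> f g = (\<chi> i j. \<Sum>a\<in>UNIV. \<Sum>b\<in>UNIV.
     entry_integral \<mu> a b (\<lambda>x. hadjoint (f x) $ i $ a * g x $ b $ j))"

subsection \<open>Consistency of the entrywise integral\<close>

lemma cinner_axis_axis:
  fixes A :: "complex^'l^'l"
  shows "cinner (axis i 1 + c *s axis j 1) (A *v (axis i 1 + c *s axis j 1)) =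
     A $ i $ i + c * A $ i $ j + cnj c * A $ j $ i + cnj c * c * A $ j $ j"
proof -
  have Av: "(A *v (axis i 1 + c *s axis j 1)) $ k = A $ k $ i + c * A $ k $ j" for k
  proof -
    have "A $ k $ m * (axis i 1 + c *s axis j 1 :: complex^'l) $ m =
       (if m = i then A $ k $ m else 0) + (if m = j then c * A $ k $ m else 0)" for m
      by (simp add: axis_def distrib_left)
    then show ?thesis
      by (simp add: matrix_vector_mult_def sum.distrib)
  qed
  have "cinner (axis i 1 + c *s axis j 1) w = w $ i + cnj c * w $ j" for w :: "complex^'l"
  proof -
    have "cnj ((axis i 1 + c *s axis j 1 :: complex^'l) $ k) * w $ k =
       (if k = i then w $ k else 0) + (if k = j then cnj c * w $ k else 0)" for k
      by (simp add: axis_def distrib_right)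
    then show ?thesis
      by (simp add: cinner_def sum.distrib)
  qed
  then show ?thesis
    by (simp only: Av) (simp add: algebra_simps)
qed

lemma polarization:
  fixes A :: "complex^'l^'l"
  shows "A $ i $ j =
    (\<Sum>k<4. (- \<i>) ^ k * cinner (polar_vec i j k) (A *v polar_vec i j k)) / 4"
proof -
  have four: "{..<4::nat} = {0, 1, 2, 3}"
    by auto
  have i2: "\<i> ^ 2 = (-1::complex)" and i3: "\<i> ^ 3 = - \<i>"
    by (simp_all add: power2_eq_square power3_eq_cube)
  show ?thesis
    by (simp add: four polar_vec_def cinner_axis_axis i2 i3) (simp add: algebra_simps)
qed

lemma cinner_hermitian_real:
  assumes "hermitian A"
  shows "cinner v (A *v v) = of_real (Re (cinner v (A *v v)))"
proof -
  have sym: "cnj (A $ i $ j) = A $ j $ i" for i j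
    using assms unfolding hermitian_def hadjoint_def by (metis vec_lambda_beta)
  have "cinner v (A *v v) = (\<Sum>i\<in>UNIV. \<Sum>j\<in>UNIV. cnj (v $ i) * (A $ i $ j * v $ j))"
    by (simp add: cinner_def matrix_vector_mult_def sum_distrib_left)
  moreover have "cnj \<dots> = (\<Sum>i\<in>UNIV. \<Sum>j\<in>UNIV. cnj (v $ j) * (A $ j $ i * v $ i))"
    by (simp add: sym mult_ac)
  moreover have "\<dots> = (\<Sum>j\<in>UNIV. \<Sum>i\<in>UNIV. cnj (v $ j) * (A $ j $ i * v $ i))"
    by (rule sum.swap)
  ultimately have "cnj (cinner v (A *v v)) = cinner v (A *v v)"
    by simp
  then show ?thesis
    by (metis Reals_cnj_iff of_real_Re)
qed

lemma sets_quad_measure [simp]: "sets (quad_measure \<mu> v) = sets borel"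
  and space_quad_measure [simp]: "space (quad_measure \<mu> v) = UNIV"
proof -
  have "sigma_algebra (UNIV :: real set) (sets borel)"
    by (metis sets.sigma_algebra_axioms space_borel)
  then show "sets (quad_measure \<mu> v) = sets borel"
    unfolding quad_measure_def by (simp add: sigma_algebra.sigma_sets_eq)
  show "space (quad_measure \<mu> v) = UNIV"
    by (simp add: quad_measure_def space_measure_of_conv)
qed

lemma emeasure_quad_measure:
  assumes \<mu>: "matrix_measure \<mu>" and E: "E \<in> sets borel"
  shows "emeasure (quad_measure \<mu> v) E = ennreal (Re (cinner v (\<mu> E *v v)))"
proof -
  have nonneg: "0 \<le> Re (cinner v (\<mu> F *v v))" if "F \<in> sets borel" for F
    using \<mu> that by (auto simp: matrix_measure_def possemidef_def)
  show ?thesis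
    unfolding quad_measure_def
  proof (rule emeasure_measure_of_sigma)
    show "sigma_algebra (UNIV :: real set) (sets borel)"
      by (metis sets.sigma_algebra_axioms space_borel)
    show "positive (sets borel) (\<lambda>E. ennreal (Re (cinner v (\<mu> E *v v))))"
      using \<mu> by (simp add: positive_def matrix_measure_def cinner_def matrix_vector_mult_def)
    show "countably_additive (sets borel) (\<lambda>E. ennreal (Re (cinner v (\<mu> E *v v))))"
      unfolding countably_additive_def
    proof (intro allI impI)
      fix F :: "nat \<Rightarrow> real set"
      assume F: "range F \<subseteq> sets borel" "disjoint_family F"
      have lin: "linear (\<lambda>A :: complex^'a^'a. Re (cinner v (A *v v)))"
        by (rule linearI) (simp_all add: cinner_def matrix_vector_mult_def sum.distrib
            sum_distrib_left algebra_simps)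
      have "(\<lambda>n. \<mu> (F n)) sums \<mu> (\<Union>n. F n)"
        using \<mu> F by (auto simp: matrix_measure_def)
      then have "(\<lambda>n. Re (cinner v (\<mu> (F n) *v v))) sums Re (cinner v (\<mu> (\<Union>n. F n) *v v))"
        using bounded_linear.sums[OF linear_linear[THEN iffD2, OF lin]]
        by (auto simp: linear_conv_bounded_linear)
      then show "(\<Sum>n. ennreal (Re (cinner v (\<mu> (F n) *v v)))) =
          ennreal (Re (cinner v (\<mu> (\<Union>n. F n) *v v)))"
        using F nonneg by (intro suminf_ennreal_eq) auto
    qed
  qed (use E in auto)
qed

lemma entry_integral_indicator:
  assumes \<mu>: "matrix_measure \<mu>" and E: "E \<in> sets borel"
  shows "entry_integral \<mu> i j (indicator E) = \<mu> E $ i $ j"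
proof -
  have herm: "hermitian (\<mu> E)"
    and nonneg: "0 \<le> Re (cinner v (\<mu> E *v v))" for v
    using \<mu> E by (auto simp: matrix_measure_def possemidef_def)
  have "(LINT x|quad_measure \<mu> v. (indicator E x :: complex)) = cinner v (\<mu> E *v v)" for v
  proof -
    have "(LINT x|quad_measure \<mu> v. (indicator E x :: complex)) =
        (LINT x|quad_measure \<mu> v. of_real (indicator E x))"
      by (intro Bochner_Integration.integral_cong) (auto simp: indicator_def)
    also have "\<dots> = of_real (measure (quad_measure \<mu> v) E)"
      using E by (simp only: integral_complex_of_real) simp
    also have "measure (quad_measure \<mu> v) E = Re (cinner v (\<mu> E *v v))"
      using nonneg by (simp add: measure_def emeasure_quad_measure[OF \<mu> E])
    finally show ?thesis
      using cinner_hermitian_real[OF herm] by simp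
  qed
  then show ?thesis
    unfolding entry_integral_def using polarization[of "\<mu> E" i j] by simp
qed


section \<open>Matrix polynomials and orthogonality\<close>

text \<open>
  The type \<open>(complex^'l^'l) poly\<close> only serves as the set of finitely supported coefficient
  sequences; evaluation is defined here because \<open>poly\<close> would use the entrywise product.
\<close>

definition mpoly_eval :: "(complex^'l^'l) poly \<Rightarrow> real \<Rightarrow> complex^'l^'l" where
  "mpoly_eval f x = (\<Sum>k\<le>degree f. x ^ k *\<^sub>R coeff f k)"

definition mp_inner ::
    "(real set \<Rightarrow> complex^'l^'l) \<Rightarrow> (complex^'l^'l) poly \<Rightarrow> (complex^'l^'l) poly
      \<Rightarrow> complex^'l^'l" where
  "mp_inner \<mu> f g = mm_inner \<mu> (mpoly_eval f) (mpoly_eval g)"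

definition nontrivial_mm :: "(real set \<Rightarrow> complex^'l^'l) \<Rightarrow> bool" where
  "nontrivial_mm \<mu> \<longleftrightarrow>
     (\<forall>f. f \<noteq> 0 \<longrightarrow> trace (mp_inner \<mu> f f) \<in> \<real> \<and> 0 < Re (trace (mp_inner \<mu> f f)))"

definition monic_orth_poly ::
    "(real set \<Rightarrow> complex^'l^'l) \<Rightarrow> nat \<Rightarrow> (complex^'l^'l) poly" where
  "monic_orth_poly \<mu> n = (THE P. degree P = n \<and> coeff P n = mat 1 \<and>
     (\<forall>f. degree f < n \<longrightarrow> mp_inner \<mu> P f = 0))"

definition orthonormal_poly ::
    "(real set \<Rightarrow> complex^'l^'l) \<Rightarrow> (nat \<Rightarrow> complex^'l^'l) \<Rightarrow> nat \<Rightarrow> real \<Rightarrow> complex^'l^'l" where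
  "orthonormal_poly \<mu> \<sigma> n x =
     mpoly_eval (monic_orth_poly \<mu> n) x
       ** inv_sqrt (mp_inner \<mu> (monic_orth_poly \<mu> n) (monic_orth_poly \<mu> n)) ** \<sigma> n"

text \<open>In the numbering from 0, the block \<open>(n, m)\<close> involves $p_n$ and $p_m$.\<close>

definition op_jacobi ::
    "(real set \<Rightarrow> complex^'l^'l) \<Rightarrow> (nat \<Rightarrow> complex^'l^'l) \<Rightarrow> 'l block_matrix" where
  "op_jacobi \<mu> \<sigma> n m =
     mm_inner \<mu> (orthonormal_poly \<mu> \<sigma> n) (\<lambda>x. x *\<^sub>R orthonormal_poly \<mu> \<sigma> m x)"

end

theory Submission
  imports Defs
begin

text \<open>
  Part (i). An equivalence class is the orbit of one matrix under sequences of unitaries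
  \<open>u\<close> with \<open>u 0 = mat 1\<close>, so it is enough that exactly one such sequence brings a given
  matrix to the wanted form. Both for type 1 and for type 3 the sequence is found one step at a time:
  once \<open>u n\<close> is known, the new off-diagonal block is \<open>M ** u (Suc n)\<close> with a known invertible \<open>M\<close>, and
  there is exactly one unitary \<open>U\<close> for which \<open>M ** U\<close> is positive definite (polar
  decomposition, \<open>polar_ex1\<close>) and exactly one for which it is lower triangular with
  positive diagonal (LQ decomposition, \<open>lq_ex1\<close>). For type 2 the products telescope: the
  transformed product of the first \<open>n\<close> off-diagonal blocks is the old one times \<open>u n\<close>, so every \<open>u n\<close> is
  given by one polar decomposition.

  The polar decomposition needs no spectral theorem. Let \<open>U\<close> maximize
  $\mathrm{Re}\,\mathrm{Tr}(MU)$ over the compact group of unitaries, and compare \<open>U\<close> with its products by the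
  unitaries that multiply one unit vector \<open>v\<close> by a phase and fix its orthogonal complement. This
  shows that $v^\dagger M U v$ is real and non-negative. The LQ
  decomposition comes from the Cholesky decomposition of $MM^\dagger$, which in turn comes from
  Gram--Schmidt orthogonalization. Cholesky and polar decomposition together give the positive
  square root: if $A = LL^\dagger$ and \<open>S = L ** U\<close> is positive definite, then $S^2 = A$.

  Part (ii). With \<open>S n\<close> the square root of $\langle\langle P_n,P_n\rangle\rangle$, comparing leading
  coefficients gives the off-diagonal blocks $A_n = \sigma_n^\dagger S_n^{-1} S_{n+1} \sigma_{n+1}$, numbered from 0, and
  hence the product of the first \<open>n\<close> of them is \<open>S n ** \<sigma> n\<close> (\<open>mat_prod_jacobi\<close>). By
  uniqueness in the polar decomposition this is positive definite only for \<open>\<sigma> n = mat 1\<close>.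

  It remains to see that the blocks are bounded. This amounts to the bound
  $\|xf\| \le r \|f\|$ for the scalar norm $\|f\|^2 = \mathrm{Tr}\langle\langle f,f\rangle\rangle$
  when the measure lives on $[-r,r]$. Integrating the pointwise bound would require positivity of
  the integral for general matrix-valued integrands. Instead, log-convexity is
  used (\<open>shift_bounded\<close>): by Cauchy--Schwarz the ratios of successive terms of
  $a_k = \|x^k f\|^2$ do not decrease, and $a_k$ grows at most like $r^{2k}$, so already
  $a_1 \le r^2 a_0$. Therefore positivity on polynomials, which is the non-triviality of the measure,
  together with entrywise estimates of integrals is enough.
\<close>

section \<open>Adjoints, the Hermitian form and unitary matrices\<close>

lemma hadjoint_nth [simp]: "hadjoint A $ i $ j = cnj (A $ j $ i)"
  by (simp add: hadjoint_def)

lemma hadjoint_hadjoint [simp]: "hadjoint (hadjoint A) = A"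
  by (simp add: vec_eq_iff)

lemma hadjoint_mat_1 [simp]: "hadjoint (mat 1) = mat 1"
  by (auto simp: vec_eq_iff mat_def)

lemma hadjoint_0 [simp]: "hadjoint 0 = 0"
  by (simp add: vec_eq_iff)

lemma hadjoint_add: "hadjoint (A + B) = hadjoint A + hadjoint B"
  by (simp add: vec_eq_iff)

lemma hadjoint_scaleR: "hadjoint (c *\<^sub>R A) = c *\<^sub>R hadjoint A"
  by (simp add: vec_eq_iff)

lemma hadjoint_mult: "hadjoint (A ** B) = hadjoint B ** hadjoint A"
  by (simp add: vec_eq_iff matrix_matrix_mult_def mult.commute)

lemma cinner_add_right: "cinner v (w + w') = cinner v w + cinner v w'"
  by (simp add: cinner_def algebra_simps sum.distrib)

lemma cinner_scale_right: "cinner v (c *s w) = c * cinner v w"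
  by (simp add: cinner_def algebra_simps sum_distrib_left)

lemma cinner_scale_left: "cinner (c *s v) w = cnj c * cinner v w"
  by (simp add: cinner_def algebra_simps sum_distrib_left)

lemma cinner_commute: "cinner v w = cnj (cinner w v)"
  by (simp add: cinner_def mult.commute)

lemma cinner_add_left: "cinner (v + v') w = cinner v w + cinner v' w"
  by (simp add: cinner_def algebra_simps sum.distrib)

lemma cinner_sum_right: "cinner v (\<Sum>k\<in>S. f k) = (\<Sum>k\<in>S. cinner v (f k))"
  by (induction S rule: infinite_finite_induct) (auto simp: cinner_add_right, auto simp: cinner_def)

lemma cinner_sum_left: "cinner (\<Sum>k\<in>S. f k) w = (\<Sum>k\<in>S. cinner (f k) w)"
  by (induction S rule: infinite_finite_induct) (auto simp: cinner_add_left, auto simp: cinner_def)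

lemma cinner_axis_left: "cinner (axis i 1) w = w $ i"
  by (simp add: cinner_def axis_def if_distrib [where f = cnj] if_distrib [where f = "\<lambda>x. x * _"] cong: if_cong)

lemma matrix_mult_axis: "(A *v axis j 1) $ i = A $ i $ j" for A :: "complex^'n^'m"
  by (simp add: matrix_vector_mult_def axis_def if_distrib cong: if_cong)

lemma cinner_self: "cinner v v = of_real ((norm v)\<^sup>2)"
proof -
  have "(norm v)\<^sup>2 = (\<Sum>i\<in>UNIV. (cmod (v $ i))\<^sup>2)"
    by (simp add: norm_vec_def L2_set_def sum_nonneg)
  then show ?thesis
    by (simp add: cinner_def complex_norm_square mult.commute del: of_real_power)
qed

lemma cinner_adjoint: "cinner v (A *v w) = cinner (hadjoint A *v v) w"
proof -
  have "cinner v (A *v w) = (\<Sum>i\<in>UNIV. \<Sum>j\<in>UNIV. cnj (v $ i) * A $ i $ j * w $ j)"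
    by (simp add: cinner_def matrix_vector_mult_def sum_distrib_left mult.assoc)
  also have "\<dots> = (\<Sum>j\<in>UNIV. \<Sum>i\<in>UNIV. cnj (v $ i) * A $ i $ j * w $ j)"
    by (rule sum.swap)
  also have "\<dots> = cinner (hadjoint A *v v) w"
    by (simp add: cinner_def matrix_vector_mult_def sum_distrib_left mult_ac)
  finally show ?thesis .
qed

text \<open>
  The entries of a congruence are values of the sesquilinear form of \<open>A\<close>. Together with its trace version
  \<open>trace_sandwich\<close>, this moves between identities of matrices and statements about vectors.
\<close>

lemma sandwich_entry: "(hadjoint V ** (A ** W)) $ i $ j = cinner (V *v axis i 1) (A *v (W *v axis j 1))"
  for A :: "complex^'n^'n"
proof -
  have "(hadjoint V ** (A ** W)) $ i $ j = ((hadjoint V ** (A ** W)) *v axis j 1) $ i"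
    by (simp only: matrix_mult_axis)
  also have "\<dots> = cinner (axis i 1) (hadjoint V *v (A *v (W *v axis j 1)))"
    by (simp only: cinner_axis_left matrix_vector_mul_assoc matrix_mul_assoc)
  also have "\<dots> = cinner (V *v axis i 1) (A *v (W *v axis j 1))"
    by (simp only: cinner_adjoint hadjoint_hadjoint)
  finally show ?thesis .
qed

lemma trace_adjoint_mult: "trace (hadjoint A ** A) = of_real ((norm A)\<^sup>2)" for A :: "complex^'n^'n"
proof -
  have "(norm A)\<^sup>2 = (\<Sum>i\<in>UNIV. \<Sum>j\<in>UNIV. (cmod (A $ i $ j))\<^sup>2)"
    by (simp add: norm_vec_def L2_set_def sum_nonneg)
  also have "\<dots> = (\<Sum>j\<in>UNIV. \<Sum>i\<in>UNIV. (cmod (A $ i $ j))\<^sup>2)"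
    by (rule sum.swap)
  finally show ?thesis
    by (simp add: trace_def matrix_matrix_mult_def complex_norm_square mult.commute del: of_real_power)
qed

lemma matrix_mult_zero [simp]: "A ** 0 = 0" "0 ** B = 0" for A :: "complex^'n^'m"
  by (simp_all add: vec_eq_iff matrix_matrix_mult_def)

lemma unitary_mult: "unitary U \<Longrightarrow> unitary V \<Longrightarrow> unitary (U ** V)"
  unfolding unitary_def hadjoint_mult
  by (metis matrix_mul_assoc matrix_mul_rid)

lemma unitary_hadjoint: "unitary U \<Longrightarrow> unitary (hadjoint U)"
  by (simp add: unitary_def)

lemma unitary_mat_1 [simp]: "unitary (mat 1)"
  by (simp add: unitary_def)

lemma unitaryI: "hadjoint U ** U = mat 1 \<Longrightarrow> unitary U"
  by (simp add: unitary_def matrix_left_right_inverse)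

lemma unitary_invertible: "unitary U \<Longrightarrow> invertible U"
  by (auto simp: unitary_def invertible_def)

lemma unitary_cancel:
  assumes "unitary U"
  shows "hadjoint U ** (U ** A) = A" "U ** (hadjoint U ** A) = A"
    "A ** hadjoint U ** U = A" "A ** U ** hadjoint U = A"
proof -
  have "hadjoint U ** U = mat 1" "U ** hadjoint U = mat 1"
    using assms by (auto simp: unitary_def)
  then show "hadjoint U ** (U ** A) = A" "U ** (hadjoint U ** A) = A"
    "A ** hadjoint U ** U = A" "A ** U ** hadjoint U = A"
    by (metis matrix_mul_assoc matrix_mul_lid matrix_mul_rid)+
qed

lemma norm_unitary_mult_left:
  fixes A :: "complex^'n^'n"
  assumes "unitary U"
  shows "norm (U ** A) = norm A"
proof -
  have "complex_of_real ((norm (U ** A))\<^sup>2) = of_real ((norm A)\<^sup>2)"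
    unfolding trace_adjoint_mult[symmetric] hadjoint_mult
    by (simp add: unitary_cancel[OF assms] flip: matrix_mul_assoc)
  then have "(norm (U ** A))\<^sup>2 = (norm A)\<^sup>2"
    by (simp only: of_real_eq_iff)
  then show ?thesis by simp
qed

lemma norm_hadjoint: "norm (hadjoint A) = norm A" for A :: "complex^'n^'n"
proof -
  have "complex_of_real ((norm (hadjoint A))\<^sup>2) = of_real ((norm A)\<^sup>2)"
    unfolding trace_adjoint_mult[symmetric] by (metis hadjoint_hadjoint trace_mul_sym)
  then have "(norm (hadjoint A))\<^sup>2 = (norm A)\<^sup>2"
    by (simp only: of_real_eq_iff)
  then show ?thesis by simp
qed

lemma norm_unitary_mult_right:
  fixes A :: "complex^'n^'n"
  assumes "unitary U"
  shows "norm (A ** U) = norm A"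
  by (metis assms hadjoint_mult norm_hadjoint norm_unitary_mult_left unitary_hadjoint)

section \<open>Positive definite matrices\<close>

lemma posdef_adjoint: "posdef A \<Longrightarrow> hadjoint A = A"
  by (simp add: posdef_def hermitian_def)

lemma posdef_mat_1: "posdef (mat 1)"
  by (simp add: posdef_def hermitian_def cinner_self)

lemma posdef_invertible:
  assumes "posdef A"
  shows "invertible A"
proof -
  have "\<forall>x. A *v x = 0 \<longrightarrow> x = 0"
    using assms unfolding posdef_def by (force simp: cinner_def)
  then show ?thesis
    by (simp add: invertible_left_inverse matrix_left_invertible_ker)
qed

lemma posdef_congruence:
  fixes A M :: "complex^'l^'l"
  assumes "posdef A" "invertible M"
  shows "posdef (hadjoint M ** A ** M)"
  unfolding posdef_def
proof (intro conjI allI impI)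
  show "hermitian (hadjoint M ** A ** M)"
    using posdef_adjoint[OF assms(1)] by (simp add: hermitian_def hadjoint_mult matrix_mul_assoc)
  fix v :: "complex^'l" assume "v \<noteq> 0"
  then have "M *v v \<noteq> 0"
    using assms(2) by (metis invertible_left_inverse matrix_left_invertible_ker)
  moreover have "cinner v (hadjoint M ** A ** M *v v) = cinner (M *v v) (A *v (M *v v))"
    by (simp add: cinner_adjoint[of v "hadjoint M"] flip: matrix_vector_mul_assoc)
  ultimately show "0 < Re (cinner v (hadjoint M ** A ** M *v v))"
    using assms(1) by (simp add: posdef_def)
qed

lemma hermitian_if_form_real:
  assumes "\<And>v. Im (cinner v (A *v v)) = 0"
  shows "hermitian A"
proof -
  have q: "Im (A $ i $ i + c * A $ i $ j + cnj c * A $ j $ i + cnj c * c * A $ j $ j) = 0" for i j c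
    using assms cinner_axis_axis[of i c j A] by metis
  have diag: "Im (A $ i $ i) = 0" for i
    using q[of i 0 i] by simp
  have "A $ j $ i = cnj (A $ i $ j)" for i j
  proof -
    have "Im (A $ i $ j) + Im (A $ j $ i) = 0"
      using q[of i 1 j] by (simp add: diag)
    moreover have "Re (A $ i $ j) - Re (A $ j $ i) = 0"
      using q[of i \<i> j] by (simp add: diag)
    ultimately show ?thesis
      by (intro complex_eqI) auto
  qed
  then show ?thesis
    unfolding hermitian_def vec_eq_iff hadjoint_nth by metis
qed

text \<open>
  Otherwise the form would be negative at \<open>v + t *s (A *v v)\<close> for small negative \<open>t\<close>: the linear
  term $2t\|Av\|^2$ dominates.
\<close>

lemma possemidef_form_zero:
  assumes "possemidef A" "Re (cinner v (A *v v)) = 0"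
  shows "A *v v = 0"
proof (rule ccontr)
  assume nz: "A *v v \<noteq> 0"
  define w where "w = A *v v"
  define b where "b = (norm w)\<^sup>2"
  define c where "c = Re (cinner w (A *v w))"
  have herm: "hadjoint A = A" using assms(1) by (simp add: possemidef_def hermitian_def)
  have b: "b > 0" using nz by (simp add: b_def w_def)
  have form: "Re (cinner (v + of_real t *s w) (A *v (v + of_real t *s w))) = 2 * t * b + t\<^sup>2 * c" for t
  proof -
    have "cinner v (A *v w) = of_real b"
      by (simp add: cinner_adjoint herm w_def[symmetric] cinner_self b_def del: of_real_power)
    moreover have "cinner w (A *v v) = of_real b"
      by (simp add: w_def[symmetric] cinner_self b_def del: of_real_power)
    ultimately show ?thesis using assms(2)
      by (simp add: matrix_vector_right_distrib vector_scalar_commute cinner_add_left cinner_add_right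
          cinner_scale_left cinner_scale_right c_def algebra_simps power2_eq_square)
  qed
  have nonneg: "0 \<le> 2 * t * b + t\<^sup>2 * c" for t
    using assms(1) form[of t] by (metis possemidef_def)
  have c: "c \<ge> 0" using assms(1) by (simp add: c_def possemidef_def)
  \<comment> \<open>The denominator \<open>c + 1\<close> instead of \<open>c\<close> covers the case \<open>c = 0\<close>.\<close>
  define t where "t = - b / (c + 1)"
  have "t * (c + 1) = - b" using c by (simp add: t_def)
  then have "2 * t * b + t\<^sup>2 * c = t * b - t\<^sup>2"
    by (simp add: power2_eq_square algebra_simps) algebra
  moreover have "t < 0" using b c by (simp add: t_def divide_neg_pos)
  ultimately show False
    using nonneg[of t] b by (smt (verit) mult_neg_pos zero_le_power2)
qed

lemma posdef_if_possemidef_invertible: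
  assumes "possemidef A" "invertible A"
  shows "posdef A"
  unfolding posdef_def
proof (intro conjI allI impI)
  show "hermitian A" using assms by (simp add: possemidef_def)
  fix v :: "complex^'a" assume "v \<noteq> 0"
  then have "A *v v \<noteq> 0"
    using assms(2) by (metis invertible_left_inverse matrix_left_invertible_ker)
  then show "0 < Re (cinner v (A *v v))"
    using possemidef_form_zero[OF assms(1)] assms(1)
    by (metis less_eq_real_def possemidef_def)
qed

subsection \<open>Uniqueness of the positive square root\<close>

lemma trace_sandwich:
  "trace (hadjoint D ** (A ** D)) = (\<Sum>j\<in>UNIV. cinner (D *v axis j 1) (A *v (D *v axis j 1)))"
  for A :: "complex^'n^'n"
  by (simp only: trace_def sandwich_entry)

text \<open>
  With \<open>D = S - T\<close>, equality of the squares gives \<open>S ** D + D ** T = 0\<close>. Multiplying by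
  $D^\dagger$ and taking the trace gives $\mathrm{Tr}(D^\dagger S D) + \mathrm{Tr}(D T D^\dagger) = 0$,
  a sum of two non-negative numbers. So the form of \<open>S\<close> vanishes on every column of \<open>D\<close>.
\<close>

lemma posdef_sqrt_unique:
  assumes S: "posdef S" and T: "posdef T" and eq: "S ** S = T ** T"
  shows "S = T"
proof -
  define D where "D = S - T"
  have nonneg: "0 \<le> Re (cinner v (A *v v))" if "posdef A" for A :: "complex^'a^'a" and v
    using that by (cases "v = 0") (auto simp: posdef_def less_imp_le cinner_def)
  have "S ** D + D ** T = 0"
  proof -
    have "S ** D + D ** T = S ** S - T ** T"
      by (simp add: D_def vec_eq_iff matrix_matrix_mult_def algebra_simps sum_subtractf)
    then show ?thesis using eq by simp
  qed
  then have "hadjoint D ** (S ** D) + hadjoint D ** (D ** T) = 0"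
    by (metis matrix_add_ldistrib matrix_mult_zero(1))
  then have "trace (hadjoint D ** (S ** D)) + trace (hadjoint D ** (D ** T)) = 0"
    unfolding trace_add[symmetric] by (simp add: trace_def)
  moreover have "trace (hadjoint D ** (D ** T)) = trace (D ** (T ** hadjoint D))"
    by (metis matrix_mul_assoc trace_mul_sym)
  ultimately have "Re (trace (hadjoint D ** (S ** D))) + Re (trace (hadjoint (hadjoint D) ** (T ** hadjoint D))) = 0"
    by (metis hadjoint_hadjoint plus_complex.sel(1) zero_complex.sel(1))
  moreover have "Re (trace (hadjoint (hadjoint D) ** (T ** hadjoint D))) \<ge> 0"
    unfolding trace_sandwich by (auto intro!: sum_nonneg nonneg[OF T])
  moreover have "Re (trace (hadjoint D ** (S ** D))) \<ge> 0"
    unfolding trace_sandwich by (auto intro!: sum_nonneg nonneg[OF S])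
  ultimately have "Re (trace (hadjoint D ** (S ** D))) = 0" by linarith
  then have "(\<Sum>j\<in>UNIV. Re (cinner (D *v axis j 1) (S *v (D *v axis j 1)))) = 0"
    unfolding trace_sandwich by simp
  then have "Re (cinner (D *v axis j 1) (S *v (D *v axis j 1))) = 0" for j
    by (subst (asm) sum_nonneg_eq_0_iff) (auto intro: nonneg[OF S])
  then have "D *v axis j 1 = 0" for j
    using S unfolding posdef_def by (metis less_irrefl)
  then have "D $ i $ j = 0" for i j
    by (metis matrix_mult_axis zero_index)
  then have "D = 0" by (simp add: vec_eq_iff)
  then show ?thesis by (simp add: D_def)
qed

lemma cinner_diff_right: "cinner v (w - w') = cinner v w - cinner v w'"
  by (simp add: cinner_def algebra_simps sum_subtractf)

section \<open>Polar decomposition\<close>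

lemma compact_unitary: "compact {U :: complex^'l^'l. unitary U}"
  unfolding compact_eq_bounded_closed
proof
  have "norm U \<le> sqrt (CARD('l))" if "unitary U" for U :: "complex^'l^'l"
  proof -
    have "complex_of_real ((norm U)\<^sup>2) = of_real (CARD('l))"
      using that unfolding trace_adjoint_mult[symmetric] by (simp add: unitary_def trace_I)
    then have "(norm U)\<^sup>2 = CARD('l)"
      by (simp only: of_real_eq_iff)
    then show ?thesis by (simp add: real_le_rsqrt)
  qed
  then show "bounded {U :: complex^'l^'l. unitary U}"
    by (auto simp: bounded_iff)
  have "{U :: complex^'l^'l. unitary U} =
      (\<Inter>i. \<Inter>j. {U. (\<Sum>k\<in>UNIV. cnj (U $ k $ i) * U $ k $ j) = mat 1 $ i $ j})"
  proof -
    have "unitary U \<longleftrightarrow> (\<forall>i j. (\<Sum>k\<in>UNIV. cnj (U $ k $ i) * U $ k $ j) = mat 1 $ i $ j)"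
      for U :: "complex^'l^'l"
    proof -
      have "unitary U \<longleftrightarrow> hadjoint U ** U = mat 1"
        by (auto simp: unitary_def matrix_left_right_inverse[of U])
      also have "\<dots> \<longleftrightarrow> (\<forall>i j. (hadjoint U ** U) $ i $ j = mat 1 $ i $ j)"
        by (simp add: vec_eq_iff)
      finally show ?thesis by (simp add: matrix_matrix_mult_def)
    qed
    then show ?thesis by auto
  qed
  also have "closed \<dots>"
    by (intro closed_INT ballI closed_Collect_eq continuous_intros)
  finally show "closed {U :: complex^'l^'l. unitary U}" .
qed

text \<open>
  \<open>E\<close> multiplies the unit vector \<open>v\<close> by the phase \<open>c\<close> and fixes its orthogonal complement. These are
  the variations that test a maximizer of $\mathrm{Re}\,\mathrm{Tr}(MU)$ in \<open>polar_exists\<close>.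
\<close>

lemma unitary_rank_one_phase:
  fixes v :: "complex^'l"
  assumes c: "cmod c = 1" and v: "cinner v v = 1"
  defines "E \<equiv> \<chi> i j. (if i = j then 1 else 0) + (c - 1) * v $ i * cnj (v $ j)"
  shows "unitary E" and "trace (N ** E) = trace N + (c - 1) * cinner v (N *v v)"
proof -
  define d where "d = c - 1"
  have "c * cnj c = 1"
    using c by (simp add: complex_norm_square[symmetric])
  then have d: "d + cnj d + d * cnj d = 0"
    by (simp add: d_def algebra_simps)
  have "(hadjoint E ** E) $ i $ j = mat 1 $ i $ j" for i j
  proof -
    have "cnj (E $ k $ i) * E $ k $ j =
        (if k = i then if i = j then 1 else 0 else 0) + (if k = i then d * v $ i * cnj (v $ j) else 0)
        + (if k = j then cnj d * v $ i * cnj (v $ j) else 0)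
        + d * cnj d * v $ i * cnj (v $ j) * (cnj (v $ k) * v $ k)" for k
      by (auto simp: E_def d_def algebra_simps)
    then have "(hadjoint E ** E) $ i $ j = (if i = j then 1 else 0) + d * v $ i * cnj (v $ j)
        + cnj d * v $ i * cnj (v $ j) + d * cnj d * v $ i * cnj (v $ j) * cinner v v"
      by (simp add: matrix_matrix_mult_def sum.distrib sum_distrib_left cinner_def)
    also have "\<dots> = (if i = j then 1 else 0) + (d + cnj d + d * cnj d) * v $ i * cnj (v $ j)"
      by (simp add: v algebra_simps)
    finally show ?thesis by (simp add: d mat_def)
  qed
  then show "unitary E" by (intro unitaryI) (simp add: vec_eq_iff)
  have "N $ i $ k * E $ k $ i = (if k = i then N $ i $ i else 0)
      + (c - 1) * (cnj (v $ i) * (N $ i $ k * v $ k))" for i k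
    by (auto simp: E_def algebra_simps)
  then show "trace (N ** E) = trace N + (c - 1) * cinner v (N *v v)"
    by (simp add: trace_def matrix_matrix_mult_def matrix_vector_mult_def sum.distrib
        sum_distrib_left cinner_def)
qed

text \<open>
  At a maximizer \<open>U\<close> of $\mathrm{Re}\,\mathrm{Tr}(MU)$ put \<open>N = M ** U\<close>. The phase variations give
  $\mathrm{Re}((c-1) z) \le 0$ for $z = v^\dagger N v$ and all phases \<open>c\<close>. The phase that makes \<open>c * z\<close>
  equal to $|z|$ shows $z = |z|$. A matrix whose form is real and non-negative is positive
  semidefinite, and \<open>N\<close> is invertible.
\<close>

lemma polar_exists:
  fixes M :: "complex^'l^'l"
  assumes "invertible M"
  shows "\<exists>U. unitary U \<and> posdef (M ** U)"
proof -
  have "continuous_on {U :: complex^'l^'l. unitary U} (\<lambda>U. Re (trace (M ** U)))"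
    unfolding trace_def matrix_matrix_mult_def by (simp, intro continuous_intros)
  then obtain U where U: "unitary U"
    and max: "\<And>V. unitary V \<Longrightarrow> Re (trace (M ** V)) \<le> Re (trace (M ** U))"
    using continuous_attains_sup[OF compact_unitary, of "\<lambda>U. Re (trace (M ** U))"] unitary_mat_1
    by (metis (mono_tags, lifting) empty_iff mem_Collect_eq)
  define N where "N = M ** U"
  have unit: "cinner v (N *v v) = of_real (cmod (cinner v (N *v v)))" if "cinner v v = 1" for v
  proof -
    define z where "z = cinner v (N *v v)"
    have le: "Re ((c - 1) * z) \<le> 0" if c: "cmod c = 1" for c
    proof -
      obtain E where "unitary E" "trace (N ** E) = trace N + (c - 1) * z"
        using unitary_rank_one_phase[OF c \<open>cinner v v = 1\<close>] unfolding z_def by blast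
      then show ?thesis
        using max[of "U ** E"] unitary_mult[OF U] by (simp add: N_def matrix_mul_assoc)
    qed
    show ?thesis
    proof (cases "z = 0")
      case False
      \<comment> \<open>The phase that rotates \<open>z\<close> onto the positive axis.\<close>
      have "(cnj z / cmod z - 1) * z = of_real (cmod z) - z"
        using False complex_norm_square[of z]
        by (simp add: field_simps power2_eq_square del: of_real_power)
      moreover have "cmod (cnj z / cmod z) = 1"
        using False by (simp add: norm_divide)
      ultimately have "cmod z \<le> Re z"
        using le[of "cnj z / cmod z"] by simp
      then have "Re z = cmod z" "Im z = 0"
        using complex_Re_le_cmod[of z] cmod_power2[of z] by (auto simp: )
      then show ?thesis by (simp add: z_def[symmetric] complex_eq_iff)
    qed (simp add: z_def)
  qed
  have real_nonneg: "cinner v (N *v v) = of_real (cmod (cinner v (N *v v)))" for v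
  proof (cases "v = 0")
    case False
    define w where "w = of_real (1 / norm v) *s v"
    have v: "v = of_real (norm v) *s w"
      using False by (simp add: w_def)
    have "cinner w w = of_real (1 / norm v) * (of_real (1 / norm v) * cinner v v)"
      by (simp only: w_def cinner_scale_left cinner_scale_right complex_cnj_complex_of_real mult.left_commute)
    then have "cinner w w = 1"
      using False by (simp add: cinner_self power2_eq_square)
    then have w: "cinner w (N *v w) = of_real (cmod (cinner w (N *v w)))"
      by (rule unit)
    have "cinner v (N *v v) = of_real ((norm v)\<^sup>2) * cinner w (N *v w)"
      by (subst v, subst (2) v)
        (simp add: vector_scalar_commute cinner_scale_left cinner_scale_right power2_eq_square)
    then show ?thesis
      using w by (metis norm_mult norm_of_real abs_power2 of_real_mult)
  qed (simp add: cinner_def)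
  have "Im (cinner v (N *v v)) = 0" "0 \<le> Re (cinner v (N *v v))" for v
    by (subst real_nonneg, simp)+
  then have "possemidef N"
    by (simp add: possemidef_def hermitian_if_form_real)
  then have "posdef N"
    by (rule posdef_if_possemidef_invertible)
      (simp add: N_def invertible_mult assms unitary_invertible U)
  then show ?thesis using U by (auto simp: N_def)
qed

lemma mult_unitary_adjoint:
  fixes M U :: "complex^'l^'l"
  assumes "unitary U"
  shows "(M ** U) ** hadjoint (M ** U) = M ** hadjoint M"
  by (simp add: hadjoint_mult unitary_cancel[OF assms] matrix_mul_assoc)

lemma invertible_cancel_left:
  assumes "invertible M" "M ** U = M ** V"
  shows "U = V"
  using assms unfolding invertible_def by (metis matrix_mul_assoc matrix_mul_lid)

text \<open>
  If \<open>M ** U\<close> is positive definite, its square is $MM^\dagger$, whatever the unitary \<open>U\<close>. So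
  uniqueness is that of the positive square root.
\<close>

lemma polar_ex1:
  fixes M :: "complex^'l^'l"
  assumes "invertible M"
  shows "\<exists>!U. unitary U \<and> posdef (M ** U)"
proof (rule ex_ex1I[OF polar_exists[OF assms]])
  fix U V assume U: "unitary U \<and> posdef (M ** U)" and V: "unitary V \<and> posdef (M ** V)"
  then have "M ** U ** (M ** U) = M ** V ** (M ** V)"
    by (metis mult_unitary_adjoint posdef_adjoint)
  then have "M ** U = M ** V"
    using U V posdef_sqrt_unique by blast
  then show "U = V"
    using assms invertible_cancel_left by blast
qed

section \<open>Cholesky decomposition\<close>

text \<open>
  A finite linear order is well-founded; triangular matrices are treated by induction on the
  index.
\<close>

lemma finite_linorder_induct:
  fixes j :: "'a :: {finite, linorder}"
  assumes "\<And>j. (\<And>k. k < j \<Longrightarrow> P k) \<Longrightarrow> P j"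
  shows "P j"
proof (induction j rule: measure_induct_rule[where f = "\<lambda>j. card {k. k < j}"])
  case (less j)
  have "card {l. l < k} < card {l. l < j}" if "k < j" for k
    using that by (intro psubset_card_mono) (auto intro: less_trans)
  then show ?case using less assms by blast
qed

text \<open>
  Gram--Schmidt orthogonalization of the standard basis for the form of \<open>A\<close>. The vectors are left
  unnormalized, so that the last non-zero coordinate of the \<open>j\<close>-th one is 1, in position \<open>j\<close>.
\<close>

function gram_schmidt :: "complex^('l::{finite,linorder})^('l::{finite,linorder}) \<Rightarrow> ('l::{finite,linorder}) \<Rightarrow> complex^('l::{finite,linorder})" where
  "gram_schmidt A j = axis j 1 - (\<Sum>k | k < j.
     (cinner (gram_schmidt A k) (A *v axis j 1)
       / cinner (gram_schmidt A k) (A *v gram_schmidt A k)) *s gram_schmidt A k)"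
  by auto
termination
  by (relation "Wellfounded.measure (\<lambda>(A, j). card {k. k < j})")
    (auto intro!: psubset_card_mono intro: less_trans)

declare gram_schmidt.simps [simp del]

lemma gram_schmidt_nth:
  shows "j < i \<Longrightarrow> gram_schmidt A j $ i = 0" "gram_schmidt A j $ j = 1"
proof -
  have *: "\<forall>i>j. gram_schmidt A j $ i = 0" for j
  proof (induction j rule: finite_linorder_induct)
    case (1 j)
    then show ?case
      by (subst gram_schmidt.simps) (auto simp: axis_def intro!: sum.neutral)
  qed
  then show "j < i \<Longrightarrow> gram_schmidt A j $ i = 0" by blast
  show "gram_schmidt A j $ j = 1"
    using * by (subst gram_schmidt.simps) (auto simp: axis_def intro!: sum.neutral)
qed

lemma gram_schmidt_orthogonal:
  assumes A: "posdef A" and "i < j"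
  shows "cinner (gram_schmidt A i) (A *v gram_schmidt A j) = 0"
proof -
  define g where "g = gram_schmidt A"
  have sym: "cinner v (A *v w) = cnj (cinner w (A *v v))" for v w
    by (metis A cinner_adjoint cinner_commute posdef_adjoint)
  have pos: "cinner (g k) (A *v g k) \<noteq> 0" for k
  proof -
    have "g k \<noteq> 0" using gram_schmidt_nth(2)[of A k] by (auto simp: g_def)
    then show ?thesis using A by (force simp: posdef_def)
  qed
  have "\<forall>i<j. cinner (g i) (A *v g j) = 0" for j
  proof (induction j rule: finite_linorder_induct)
    case (1 j)
    show ?case
    proof (intro allI impI)
      fix i assume "i < j"
      have orth: "cinner (g i) (A *v g k) = 0" if "k < j" "k \<noteq> i" for k
        using 1 that \<open>i < j\<close> sym[of "g i" "g k"] by (cases i k rule: linorder_cases) auto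
      have "cinner (g i) (A *v g j) = cinner (g i) (A *v axis j 1) - (\<Sum>k | k < j.
          cinner (g k) (A *v axis j 1) / cinner (g k) (A *v g k) * cinner (g i) (A *v g k))"
        unfolding g_def
        by (subst (2) gram_schmidt.simps)
          (simp add: matrix_vector_mult_diff_distrib vector_scalar_commute cinner_add_right
            cinner_scale_right cinner_sum_right cinner_diff_right linear_sum[OF matrix_vector_mul_linear])
      also have "(\<Sum>k | k < j.
          cinner (g k) (A *v axis j 1) / cinner (g k) (A *v g k) * cinner (g i) (A *v g k))
        = (\<Sum>k\<in>{i}. cinner (g k) (A *v axis j 1) / cinner (g k) (A *v g k) * cinner (g i) (A *v g k))"
        using orth \<open>i < j\<close> by (intro sum.mono_neutral_right) auto
      finally show "cinner (g i) (A *v g j) = 0" using pos by simp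
    qed
  qed
  then show ?thesis using \<open>i < j\<close> by (simp add: g_def)
qed

lemma gram_schmidt_form_pos:
  assumes A: "posdef A"
  shows "0 < Re (cinner (gram_schmidt A j) (A *v gram_schmidt A j))"
proof -
  have "gram_schmidt A j \<noteq> 0" using gram_schmidt_nth(2)[of A j] by auto
  then show ?thesis using A by (simp add: posdef_def)
qed

text \<open>
  Let the columns of \<open>R\<close> be the normalized Gram--Schmidt vectors, so that $R^\dagger A R$ is the unit
  matrix, and put \<open>L = A ** R\<close>. Then $LL^\dagger = A (R R^\dagger A) = A$. The matrix \<open>L\<close> is
  lower triangular, since the \<open>i\<close>-th basis vector lies in the span of the Gram--Schmidt vectors up to
  \<open>i\<close>, and these are orthogonal to all later ones.
\<close>

lemma cholesky_exists:
  fixes A :: "complex^('l::{finite,linorder})^('l::{finite,linorder})"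
  assumes A: "posdef A"
  shows "\<exists>L. lower_triangular_pos L \<and> L ** hadjoint L = A"
proof -
  define g where "g = gram_schmidt A"
  define d where "d j = Re (cinner (g j) (A *v g j))" for j
  have d_pos: "d j > 0" for j
    using gram_schmidt_form_pos[OF A] by (simp add: d_def g_def)
  have d: "cinner (g j) (A *v g j) = of_real (d j)" for j
    using A cinner_hermitian_real unfolding d_def posdef_def by blast
  have sym: "cinner v (A *v w) = cnj (cinner w (A *v v))" for v w
    by (metis A cinner_adjoint cinner_commute posdef_adjoint)
  define R where "R = (\<chi> i j. complex_of_real (1 / sqrt (d j)) * g j $ i)"
  have R: "R *v axis j 1 = complex_of_real (1 / sqrt (d j)) *s g j" for j
    by (simp add: vec_eq_iff matrix_mult_axis R_def)
  have "(hadjoint R ** (A ** R)) $ i $ j = mat 1 $ i $ j" for i j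
  proof -
    have entry: "(hadjoint R ** (A ** R)) $ i $ j
        = of_real (1 / sqrt (d j)) * (of_real (1 / sqrt (d i)) * cinner (g i) (A *v g j))"
      by (simp only: sandwich_entry R vector_scalar_commute cinner_scale_left cinner_scale_right
          complex_cnj_complex_of_real)
    show ?thesis
    proof (cases i j rule: linorder_cases)
      case less
      then show ?thesis using gram_schmidt_orthogonal[OF A less] entry by (simp add: mat_def g_def)
    next
      case equal
      have "complex_of_real (sqrt (d j)) * complex_of_real (sqrt (d j)) = of_real (d j)"
        using d_pos[of j] by (simp flip: of_real_mult)
      then show ?thesis using entry d_pos[of j] equal by (simp add: mat_def d field_simps)
    next
      case greater
      then show ?thesis using gram_schmidt_orthogonal[OF A greater] entry sym[of "g i" "g j"]
        by (simp add: mat_def g_def)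
    qed
  qed
  then have RAR: "hadjoint R ** (A ** R) = mat 1"
    by (simp add: vec_eq_iff)
  define L where "L = A ** R"
  have "L ** hadjoint L = A ** (R ** (hadjoint R ** A))"
    by (simp add: L_def hadjoint_mult posdef_adjoint[OF A] matrix_mul_assoc)
  also have "R ** (hadjoint R ** A) = mat 1"
    using RAR by (metis matrix_left_right_inverse matrix_mul_assoc)
  finally have LL: "L ** hadjoint L = A" by simp
  have L: "L $ i $ j = of_real (1 / sqrt (d j)) * cinner (axis i 1) (A *v g j)" for i j
  proof -
    have "L $ i $ j = (L *v axis j 1) $ i"
      by (simp only: matrix_mult_axis)
    also have "L *v axis j 1 = A *v (of_real (1 / sqrt (d j)) *s g j)"
      by (simp only: L_def R flip: matrix_vector_mul_assoc)
    finally show ?thesis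
      by (simp only: cinner_axis_left vector_scalar_commute vector_smult_component)
  qed
  have axis: "cinner (axis i 1) w = cinner (g i) w + (\<Sum>k | k < i. cnj
     (cinner (g k) (A *v axis i 1) / cinner (g k) (A *v g k)) * cinner (g k) w)" for i w
  proof -
    have "axis i 1 = g i + (\<Sum>k | k < i.
       (cinner (g k) (A *v axis i 1) / cinner (g k) (A *v g k)) *s g k)"
      unfolding g_def by (subst gram_schmidt.simps) simp
    then have "cinner (axis i 1) w = cinner (g i + (\<Sum>k | k < i.
       (cinner (g k) (A *v axis i 1) / cinner (g k) (A *v g k)) *s g k)) w"
      by simp
    then show ?thesis
      by (simp only: cinner_add_left cinner_sum_left cinner_scale_left)
  qed
  have "cinner (axis i 1) (A *v g j) = cinner (g i) (A *v g j)" if "i \<le> j" for i j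
  proof -
    have "cinner (g k) (A *v g j) = 0" if "k < i" for k
      using gram_schmidt_orthogonal[OF A] \<open>i \<le> j\<close> that by (simp add: g_def)
    then show ?thesis by (subst axis) simp
  qed
  then have "L $ i $ j = of_real (1 / sqrt (d j)) * cinner (g i) (A *v g j)" if "i \<le> j" for i j
    using that L by simp
  then have "L $ i $ j = 0" if "i < j" for i j
    using that gram_schmidt_orthogonal[OF A] by (simp add: g_def)
  moreover have "L $ j $ j = of_real (d j / sqrt (d j))" for j
    using \<open>\<And>i j. i \<le> j \<Longrightarrow> L $ i $ j = of_real (1 / sqrt (d j)) * cinner (g i) (A *v g j)\<close>[of j j]
    by (simp add: d)
  ultimately have "lower_triangular_pos L"
    using d_pos unfolding lower_triangular_pos_def by simp
  then show ?thesis using LL by blast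
qed

text \<open>
  The factor is determined column by column: when the columns before \<open>j\<close> agree, the entry \<open>(j, j)\<close> of the
  product determines the diagonal element, and the entries \<open>(i, j)\<close> then determine the rest of
  column \<open>j\<close>.
\<close>

lemma cholesky_unique:
  fixes L K :: "complex^('l::{finite,linorder})^('l::{finite,linorder})"
  assumes L: "lower_triangular_pos L" and K: "lower_triangular_pos K"
    and eq: "L ** hadjoint L = K ** hadjoint K"
  shows "L = K"
proof -
  have "\<forall>i. L $ i $ j = K $ i $ j" for j
  proof (induction j rule: finite_linorder_induct)
    case (1 j)
    have expand: "(M ** hadjoint M) $ i $ j
        = (\<Sum>k | k < j. M $ i $ k * cnj (M $ j $ k)) + M $ i $ j * cnj (M $ j $ j)"
      if M: "lower_triangular_pos M" for M i
    proof -
      have "(M ** hadjoint M) $ i $ j = (\<Sum>k\<in>insert j {k. k < j}. M $ i $ k * cnj (M $ j $ k))"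
      proof -
        have "M $ j $ k = 0" if "k \<notin> insert j {k. k < j}" for k
          using that M unfolding lower_triangular_pos_def by (metis insertCI linorder_cases mem_Collect_eq)
        then show ?thesis
          unfolding matrix_matrix_mult_def vec_lambda_beta hadjoint_nth
          by (intro sum.mono_neutral_right) auto
      qed
      then show ?thesis by simp
    qed
    have step: "L $ i $ j * cnj (L $ j $ j) = K $ i $ j * cnj (K $ j $ j)" for i
    proof -
      have "(\<Sum>k | k < j. L $ i $ k * cnj (L $ j $ k)) = (\<Sum>k | k < j. K $ i $ k * cnj (K $ j $ k))"
        using 1 by (intro sum.cong) auto
      then show ?thesis using expand[OF L, of i] expand[OF K, of i] eq by simp
    qed
    have real: "M $ j $ j = of_real (Re (M $ j $ j))" "Re (M $ j $ j) > 0"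
      if "lower_triangular_pos M" for M
      using that unfolding lower_triangular_pos_def by (metis of_real_Re)+
    have "complex_of_real (Re (L $ j $ j) * Re (L $ j $ j)) = of_real (Re (K $ j $ j) * Re (K $ j $ j))"
      using step[of j] real(1)[OF L] real(1)[OF K]
      by (metis complex_cnj_complex_of_real of_real_mult)
    then have "(Re (L $ j $ j))\<^sup>2 = (Re (K $ j $ j))\<^sup>2"
      unfolding of_real_eq_iff power2_eq_square .
    then have diag: "L $ j $ j = K $ j $ j"
      using real[OF L] real[OF K] by (metis less_imp_le power2_eq_imp_eq)
    then show ?case
      using step real(2)[OF K] by (metis complex_cnj_zero_iff less_irrefl mult_right_cancel zero_complex.sel(1))
  qed
  then show ?thesis by (simp add: vec_eq_iff)
qed

lemma invertible_hadjoint: "invertible M \<Longrightarrow> invertible (hadjoint M)"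
  unfolding invertible_def by (metis hadjoint_mat_1 hadjoint_mult)

text \<open>
  For invertible \<open>M\<close>, the products of \<open>M\<close> with unitaries are the matrices \<open>L\<close> with $LL^\dagger = MM^\dagger$. Exactly one
  of them is a Cholesky factor.
\<close>

lemma lq_ex1:
  fixes M :: "complex^('l::{finite,linorder})^('l::{finite,linorder})"
  assumes "invertible M"
  shows "\<exists>!U. unitary U \<and> lower_triangular_pos (M ** U)"
proof (rule ex_ex1I)
  have "posdef (M ** hadjoint M)"
    using posdef_congruence[OF posdef_mat_1 invertible_hadjoint[OF assms]] by simp
  then obtain L where L: "lower_triangular_pos L" "L ** hadjoint L = M ** hadjoint M"
    using cholesky_exists by blast
  obtain N where N: "N ** M = mat 1" "M ** N = mat 1"
    using assms by (auto simp: invertible_def)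
  have "(N ** L) ** hadjoint (N ** L) = N ** (L ** hadjoint L) ** hadjoint N"
    by (simp add: hadjoint_mult matrix_mul_assoc)
  also have "\<dots> = (N ** M) ** hadjoint (N ** M)"
    by (simp add: L hadjoint_mult matrix_mul_assoc)
  finally have "unitary (N ** L)"
    by (simp add: N unitary_def matrix_left_right_inverse)
  moreover have "M ** (N ** L) = L"
    by (simp add: matrix_mul_assoc N)
  ultimately show "\<exists>U. unitary U \<and> lower_triangular_pos (M ** U)"
    using L(1) by metis
next
  fix U V assume U: "unitary U \<and> lower_triangular_pos (M ** U)"
    and V: "unitary V \<and> lower_triangular_pos (M ** V)"
  then have "M ** U = M ** V"
    by (metis cholesky_unique mult_unitary_adjoint)
  then show "U = V"
    using assms invertible_cancel_left by blast
qed

text \<open>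
  Correcting a Cholesky factor \<open>L\<close> by the unitary from its polar decomposition keeps $LL^\dagger$ and makes the
  factor self-adjoint.
\<close>

lemma posdef_sqrt_exists:
  fixes A :: "complex^('l::{finite,linorder})^('l::{finite,linorder})"
  assumes "posdef A"
  shows "\<exists>S. posdef S \<and> S ** S = A"
proof -
  obtain L where "lower_triangular_pos L" and L: "L ** hadjoint L = A"
    using cholesky_exists[OF assms] by blast
  then have "invertible L"
    using posdef_invertible[OF assms] unfolding invertible_right_inverse
    by (metis matrix_mul_assoc)
  then obtain U where U: "unitary U" "posdef (L ** U)"
    using polar_exists by blast
  then have "(L ** U) ** (L ** U) = A"
    using mult_unitary_adjoint[OF U(1), of L] posdef_adjoint[OF U(2)] L by simp
  then show ?thesis using U by blast
qed

lemma pd_sqrt: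
  fixes A :: "complex^('l::{finite,linorder})^('l::{finite,linorder})"
  assumes "posdef A"
  shows "posdef (pd_sqrt A)" "pd_sqrt A ** pd_sqrt A = A"
proof -
  have "\<exists>!S. posdef S \<and> S ** S = A"
    using posdef_sqrt_exists[OF assms] posdef_sqrt_unique by metis
  from theI'[OF this] show "posdef (pd_sqrt A)" "pd_sqrt A ** pd_sqrt A = A"
    by (auto simp: pd_sqrt_def)
qed

section \<open>Equivalence classes of block Jacobi matrices\<close>

definition unitary_gauge :: "(nat \<Rightarrow> complex^'l^'l) \<Rightarrow> bool" where
  "unitary_gauge u \<longleftrightarrow> (\<forall>n. unitary (u n)) \<and> u 0 = mat 1"

definition gauge_transform :: "(nat \<Rightarrow> complex^'l^'l) \<Rightarrow> 'l block_matrix \<Rightarrow> 'l block_matrix" where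
  "gauge_transform u J n m = hadjoint (u n) ** J n m ** u m"

lemma det_nonzero_iff_invertible: "det A \<noteq> 0 \<longleftrightarrow> invertible A" for A :: "complex^'l^'l"
  by (simp add: invertible_det_nz)

lemma gauge_transform_block_jacobi:
  assumes u: "unitary_gauge u" and J: "J \<in> block_jacobi"
  shows "gauge_transform u J \<in> block_jacobi"
proof -
  obtain A B where J: "J = jacobi_blocks A B" and B: "\<And>n. hermitian (B n)"
    and A: "\<And>n. det (A n) \<noteq> 0" and bdd: "bdd_above (range (\<lambda>n. norm (A n) + norm (B n)))"
    using J by (auto simp: block_jacobi_def)
  have U: "unitary (u n)" for n using u by (simp add: unitary_gauge_def)
  define A' where "A' n = hadjoint (u n) ** A n ** u (Suc n)" for n
  define B' where "B' n = hadjoint (u n) ** B n ** u n" for n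
  have "gauge_transform u J = jacobi_blocks A' B'"
    by (auto simp: fun_eq_iff gauge_transform_def J jacobi_blocks_def A'_def B'_def hadjoint_mult
        matrix_mul_assoc)
  moreover have "hermitian (B' n)" for n
    using B[of n] by (simp add: hermitian_def B'_def hadjoint_mult matrix_mul_assoc)
  moreover have "det (A' n) \<noteq> 0" for n
    using A unfolding det_nonzero_iff_invertible A'_def
    by (intro invertible_mult unitary_invertible[OF U] unitary_invertible[OF unitary_hadjoint[OF U]])
  moreover have "norm (A' n) + norm (B' n) = norm (A n) + norm (B n)" for n
    by (simp add: A'_def B'_def norm_unitary_mult_right norm_unitary_mult_left U unitary_hadjoint)
  ultimately show ?thesis
    using bdd unfolding block_jacobi_def
    by (intro CollectI exI[of _ A'] exI[of _ B'] conjI) simp_all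
qed

lemma block_jacobi_equiv_iff:
  assumes "J \<in> block_jacobi"
  shows "(J, J') \<in> block_jacobi_equiv \<longleftrightarrow> (\<exists>u. unitary_gauge u \<and> J' = gauge_transform u J)"
proof -
  have "J' = gauge_transform u J \<longleftrightarrow> (\<forall>n m. J' n m = hadjoint (u n) ** J n m ** u m)" for u
    by (simp add: fun_eq_iff gauge_transform_def)
  then show ?thesis
    using assms gauge_transform_block_jacobi[of _ J]
    unfolding block_jacobi_equiv_def by (auto simp: unitary_gauge_def) metis
qed

text \<open>
  Existence and uniqueness in an equivalence class can be checked on the gauges that start from one
  chosen representative.
\<close>

lemma class_ex1_if_gauge_ex1:
  assumes "J \<in> block_jacobi" and "\<exists>!u. unitary_gauge u \<and> T (gauge_transform u J)"
  shows "\<exists>!J'. J' \<in> block_jacobi_equiv `` {J} \<and> T J'"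
  using assms(2) unfolding Image_singleton_iff block_jacobi_equiv_iff[OF assms(1)] by metis

lemma off_diagonal_invertible:
  assumes "J \<in> block_jacobi"
  shows "invertible (J n (Suc n))"
  using assms unfolding block_jacobi_def
  by (auto simp: jacobi_blocks_def det_nonzero_iff_invertible)

text \<open>
  Covers types 1 and 3. The \<open>n\<close>-th off-diagonal block of the transformed matrix is the product of a
  matrix that depends only on \<open>u n\<close> with \<open>u (Suc n)\<close>, so the unitaries are forced one after the other, beginning with
  \<open>u 0 = mat 1\<close>.
\<close>

lemma gauge_ex1_entrywise:
  fixes J :: "('l::finite) block_matrix" and Q :: "complex^'l^'l \<Rightarrow> bool"
  assumes J: "J \<in> block_jacobi"
    and Q: "\<And>M. invertible M \<Longrightarrow> \<exists>!U. unitary U \<and> Q (M ** U)"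
  shows "\<exists>!u. unitary_gauge u \<and> (\<forall>n. Q (gauge_transform u J n (Suc n)))"
proof -
  have inv: "invertible (hadjoint V ** J n (Suc n))" if "unitary V" for n V
    by (intro invertible_mult unitary_invertible unitary_hadjoint that off_diagonal_invertible[OF J])
  show ?thesis
  proof (rule ex_ex1I)
    have "\<exists>u. \<forall>n. (unitary (u n) \<and> (n = 0 \<longrightarrow> u n = mat 1))
        \<and> Q (hadjoint (u n) ** J n (Suc n) ** u (Suc n))"
    proof (rule dependent_nat_choice)
      show "\<exists>x. unitary x \<and> (0 = (0::nat) \<longrightarrow> x = mat 1)"
        by auto
      fix x :: "complex^'l^'l" and n :: nat assume "unitary x \<and> (n = 0 \<longrightarrow> x = mat 1)"
      then show "\<exists>y. (unitary y \<and> (Suc n = 0 \<longrightarrow> y = mat 1)) \<and> Q (hadjoint x ** J n (Suc n) ** y)"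
        using Q[OF inv, of x n] by auto
    qed
    then show "\<exists>u. unitary_gauge u \<and> (\<forall>n. Q (gauge_transform u J n (Suc n)))"
      unfolding unitary_gauge_def gauge_transform_def by metis
  next
    fix u v
    assume u: "unitary_gauge u \<and> (\<forall>n. Q (gauge_transform u J n (Suc n)))"
      and v: "unitary_gauge v \<and> (\<forall>n. Q (gauge_transform v J n (Suc n)))"
    have "u n = v n" for n
    proof (induction n)
      case 0
      then show ?case using u v by (simp add: unitary_gauge_def)
    next
      case (Suc n)
      have "unitary (u n)" using u by (simp add: unitary_gauge_def)
      then show ?case
        using u v Q[OF inv, of "u n" n] Suc unfolding unitary_gauge_def gauge_transform_def by metis
    qed
    then show "u = v" by (simp add: fun_eq_iff)
  qed
qed

lemma mat_prod_gauge_transform: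
  assumes "unitary_gauge u"
  shows "mat_prod (\<lambda>k. gauge_transform u J k (Suc k)) n = mat_prod (\<lambda>k. J k (Suc k)) n ** u n"
proof (induction n)
  case 0
  then show ?case using assms by (simp add: unitary_gauge_def)
next
  case (Suc n)
  have "unitary (u n)" using assms by (simp add: unitary_gauge_def)
  then show ?case
    by (simp add: Suc matrix_mul_assoc unitary_cancel)
      (simp add: gauge_transform_def matrix_mul_assoc unitary_cancel)
qed

lemma mat_prod_invertible:
  assumes "\<And>n. invertible (A n)"
  shows "invertible (mat_prod A n :: complex^'l^'l)"
proof (induction n)
  case 0
  show ?case by (auto simp: invertible_def intro: exI[of _ "mat 1"])
next
  case (Suc n)
  then show ?case by (simp add: invertible_mult assms)
qed

text \<open>
  By \<open>mat_prod_gauge_transform\<close> each \<open>u n\<close> must be the unitary of the polar decomposition of the product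
  of the first \<open>n\<close> off-diagonal blocks. At \<open>n = 0\<close> this unitary is the unit matrix, as a gauge requires.
\<close>

lemma gauge_ex1_type2:
  assumes J: "J \<in> block_jacobi"
  shows "\<exists>!u. unitary_gauge u \<and> type2 (gauge_transform u J)"
proof -
  define A where "A = mat_prod (\<lambda>k. J k (Suc k))"
  have ex1: "\<exists>!U. unitary U \<and> posdef (A n ** U)" for n
    unfolding A_def by (intro polar_ex1 mat_prod_invertible off_diagonal_invertible[OF J])
  then obtain w where w: "\<And>n. unitary (w n) \<and> posdef (A n ** w n)" by metis
  have one: "posdef (A 0 ** mat 1)" by (simp add: A_def posdef_mat_1)
  have iff: "unitary_gauge u \<and> type2 (gauge_transform u J) \<longleftrightarrow> u = w" for u
  proof
    assume u: "unitary_gauge u \<and> type2 (gauge_transform u J)"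
    then have "posdef (A n ** u n)" for n
      using one unfolding type2_def A_def
      by (cases "n = 0") (auto simp: mat_prod_gauge_transform unitary_gauge_def)
    then have "u n = w n" for n
      using ex1[of n] w[of n] u unfolding unitary_gauge_def by metis
    then show "u = w" by (simp add: fun_eq_iff)
  next
    assume "u = w"
    moreover have "w 0 = mat 1"
      using ex1[of 0] w[of 0] one unitary_mat_1 by metis
    ultimately have "unitary_gauge u" using w by (simp add: unitary_gauge_def)
    then show "unitary_gauge u \<and> type2 (gauge_transform u J)"
      using w \<open>u = w\<close> by (simp add: type2_def mat_prod_gauge_transform A_def)
  qed
  show ?thesis unfolding iff by simp
qed

theorem equivalence_class_normal_forms:
  fixes C :: "('l::{finite,linorder}) block_matrix set"
  assumes "C \<in> block_jacobi // block_jacobi_equiv"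
  shows "\<exists>!J. J \<in> C \<and> type1 J" "\<exists>!J. J \<in> C \<and> type2 J" "\<exists>!J. J \<in> C \<and> type3 J"
proof -
  obtain J where J: "J \<in> block_jacobi" and C: "C = block_jacobi_equiv `` {J}"
    using assms by (rule quotientE)
  show "\<exists>!J. J \<in> C \<and> type1 J" unfolding C type1_def
    by (intro class_ex1_if_gauge_ex1[OF J] gauge_ex1_entrywise[OF J] polar_ex1)
  show "\<exists>!J. J \<in> C \<and> type2 J" unfolding C
    by (intro class_ex1_if_gauge_ex1[OF J] gauge_ex1_type2[OF J])
  show "\<exists>!J. J \<in> C \<and> type3 J" unfolding C type3_def
    by (intro class_ex1_if_gauge_ex1[OF J] gauge_ex1_entrywise[OF J] lq_ex1)
qed

section \<open>Orthogonal polynomials of a matrix-valued inner product\<close>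

text \<open>
  In contrast to \<open>complex^'l^'l\<close>, this notation puts no sort on \<open>'l\<close>, which has to carry a linear order in
  the locales below.
\<close>

type_synonym 'l cmat = "complex^'l^'l"

text \<open>
  The product of the type \<open>poly\<close> would multiply coefficients entrywise, so matrices act on polynomials through this
  operation. Multiplication by the variable is \<open>pCons 0\<close>.
\<close>

definition mult_coeffs :: "(complex^'l^'l) poly \<Rightarrow> complex^'l^'l \<Rightarrow> (complex^'l^'l) poly" where
  "mult_coeffs f C = map_poly (\<lambda>A. A ** C) f"

lemma coeff_mult_coeffs [simp]: "coeff (mult_coeffs f C) k = coeff f k ** C"
  by (simp add: mult_coeffs_def coeff_map_poly)

lemma degree_mult_coeffs: "degree (mult_coeffs f C) \<le> degree f"
  by (rule degree_le) (simp add: coeff_eq_0)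

lemma mult_coeffs_pCons_0: "mult_coeffs (pCons 0 f) C = pCons 0 (mult_coeffs f C)"
  by (rule poly_eqI) (auto simp: coeff_pCons split: nat.split)

lemma matrix_mult_scaled_unit: "A ** (r *\<^sub>R mat 1) = r *\<^sub>R A" for A :: "complex^'l^'l"
  by (simp add: vec_eq_iff matrix_matrix_mult_def mat_def if_distrib cong: if_cong)

lemma trace_hadjoint: "trace (hadjoint A) = cnj (trace A)"
  by (simp add: trace_def)

lemma Re_trace_scaleR: "Re (trace (r *\<^sub>R A)) = r * Re (trace A)"
  by (simp add: trace_def sum_distrib_left)

lemma matrix_inv_cancel:
  fixes A :: "complex^'l^'l"
  assumes "invertible A"
  shows "matrix_inv A ** A = mat 1" "A ** matrix_inv A = mat 1"
  using someI_ex[OF assms[unfolded invertible_def]] by (auto simp: matrix_inv_def)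

text \<open>
  The properties of $\langle\langle f,g\rangle\rangle_R$ that the theory of orthogonal polynomials uses. The symmetry
  \<open>ip_shift\<close> says that the measure lives on the real line, and \<open>ip_growth\<close> that its support lies
  in $[-\sqrt R, \sqrt R]$.
\<close>

locale matrix_inner_product =
  fixes ip :: "('l::{finite,linorder}) cmat poly \<Rightarrow> ('l::{finite,linorder}) cmat poly
      \<Rightarrow> ('l::{finite,linorder}) cmat"
    and R :: real
  assumes ip_add_right: "ip f (g + h) = ip f g + ip f h"
    and ip_mult_right: "ip f (mult_coeffs g C) = ip f g ** C"
    and ip_adjoint: "hadjoint (ip f g) = ip g f"
    and ip_shift: "ip (pCons 0 f) g = ip f (pCons 0 g)"
    and ip_trace_pos: "f \<noteq> 0 \<Longrightarrow> 0 < Re (trace (ip f f))"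
    and R_pos: "0 < R"
    and ip_growth: "\<exists>K. \<forall>k. Re (trace (ip ((pCons 0 ^^ k) f) ((pCons 0 ^^ k) f))) \<le> K * R ^ k"
begin

lemma ip_0_right [simp]: "ip f 0 = 0"
  using ip_add_right[of f 0 0] by simp

lemma ip_diff_right: "ip f (g - h) = ip f g - ip f h"
  using ip_add_right[of f "g - h" h] by (simp add: algebra_simps)

lemma ip_sum_right: "ip f (\<Sum>k\<in>S. g k) = (\<Sum>k\<in>S. ip f (g k))"
  by (induction S rule: infinite_finite_induct) (auto simp: ip_add_right)

lemma ip_add_left: "ip (f + g) h = ip f h + ip g h"
  by (metis hadjoint_add ip_add_right ip_adjoint)

lemma ip_diff_left: "ip (f - g) h = ip f h - ip g h"
  using ip_add_left[of "f - g" g h] by (simp add: algebra_simps)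

lemma ip_mult_left: "ip (mult_coeffs f C) g = hadjoint C ** ip f g"
  by (metis hadjoint_mult ip_adjoint ip_mult_right)

lemma ip_zero_commute: "ip f g = 0 \<Longrightarrow> ip g f = 0"
  by (metis hadjoint_0 ip_adjoint)

definition sqnorm :: "('l::{finite,linorder}) cmat poly \<Rightarrow> real" where
  "sqnorm f = Re (trace (ip f f))"

lemma sqnorm_nonneg: "0 \<le> sqnorm f"
  using ip_trace_pos[of f] by (cases "f = 0") (auto simp: sqnorm_def trace_def less_imp_le)

lemma trace_ip_Cauchy_Schwarz: "(Re (trace (ip f g)))\<^sup>2 \<le> sqnorm f * sqnorm g"
proof (cases "g = 0")
  case True
  then show ?thesis by (simp add: sqnorm_def trace_def)
next
  case False
  define b where "b = Re (trace (ip f g))"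
  \<comment> \<open>The minimizer of the squared norm of \<open>f - t g\<close> over real \<open>t\<close>.\<close>
  define t where "t = b / sqnorm g"
  define h where "h = mult_coeffs g (t *\<^sub>R mat 1)"
  have pos: "sqnorm g > 0" using False ip_trace_pos by (simp add: sqnorm_def)
  have "hadjoint (t *\<^sub>R mat 1 :: 'l cmat) ** A = t *\<^sub>R A" for A :: "'l cmat"
    by (simp add: hadjoint_scaleR vec_eq_iff matrix_matrix_mult_def mat_def if_distrib if_distribR cong: if_cong)
  then have "ip (f - h) (f - h) = ip f f - t *\<^sub>R ip f g - t *\<^sub>R ip g f + t *\<^sub>R t *\<^sub>R ip g g"
    unfolding h_def ip_diff_left ip_diff_right ip_mult_left ip_mult_right matrix_mult_scaled_unit
    by (simp add: algebra_simps)
  moreover have "Re (trace (ip g f)) = b"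
    unfolding b_def by (metis cnj.sel(1) ip_adjoint trace_hadjoint)
  ultimately have "sqnorm (f - h) = sqnorm f - 2 * t * b + t * t * sqnorm g"
    by (simp add: sqnorm_def trace_add trace_sub Re_trace_scaleR b_def)
  then have "0 \<le> sqnorm f - 2 * t * b + t * t * sqnorm g"
    using sqnorm_nonneg by metis
  moreover have "t * sqnorm g = b" using pos by (simp add: t_def)
  moreover from this have "t * t * sqnorm g = t * b" by (simp add: mult.assoc)
  ultimately have "0 \<le> sqnorm f - t * b" by linarith
  then have "0 \<le> (sqnorm f - t * b) * sqnorm g" using pos by simp
  also have "\<dots> = sqnorm f * sqnorm g - b * (t * sqnorm g)" by (simp add: algebra_simps)
  also have "\<dots> = sqnorm f * sqnorm g - b\<^sup>2"
    unfolding \<open>t * sqnorm g = b\<close> power2_eq_square ..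
  finally show ?thesis by (simp add: b_def)
qed

text \<open>
  Write $a_k = \|x^k f\|^2$. By \<open>ip_shift\<close>, $a_{k+1}$ is also the inner product of
  $x^k f$ and $x^{k+2} f$, so Cauchy--Schwarz gives $a_{k+1}^2 \le a_k a_{k+2}$. Hence $a_k \ge a_0 \rho^k$ with
  $\rho = a_1/a_0$, and \<open>ip_growth\<close> allows this only for $\rho \le R$.
\<close>

lemma shift_bounded: "sqnorm (pCons 0 f) \<le> R * sqnorm f"
proof (cases "f = 0")
  case True
  then show ?thesis by (simp add: sqnorm_def trace_def)
next
  case False
  define a where "a k = sqnorm ((pCons 0 ^^ k) f)" for k
  have "(pCons 0 ^^ k) f \<noteq> 0" for k
    using False by (induction k) auto
  then have a_pos: "a k > 0" for k
    using ip_trace_pos by (simp add: a_def sqnorm_def)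
  have log_convex: "(a (Suc k))\<^sup>2 \<le> a k * a (Suc (Suc k))" for k
    using trace_ip_Cauchy_Schwarz[of "(pCons 0 ^^ k) f" "(pCons 0 ^^ Suc (Suc k)) f"]
    by (simp add: a_def sqnorm_def ip_shift)
  define \<rho> where "\<rho> = a 1 / a 0"
  have \<rho>: "\<rho> > 0" by (simp add: \<rho>_def a_pos)
  have ratio: "\<rho> * a k \<le> a (Suc k)" for k
  proof (induction k)
    case 0
    show ?case using a_pos[of 0] by (simp add: \<rho>_def)
  next
    case (Suc k)
    have "\<rho> * a (Suc k) * a k \<le> a (Suc k) * a (Suc k)"
      using mult_left_mono[OF Suc, of "a (Suc k)"] a_pos[of "Suc k"] by (simp add: mult_ac)
    also have "\<dots> \<le> a (Suc (Suc k)) * a k"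
      using log_convex[of k] by (simp add: power2_eq_square mult_ac)
    finally show ?case using a_pos[of k] by simp
  qed
  have geometric: "a 0 * \<rho> ^ k \<le> a k" for k
  proof (induction k)
    case (Suc k)
    have "a 0 * \<rho> ^ Suc k \<le> \<rho> * a k"
      using mult_left_mono[OF Suc, of \<rho>] \<rho> by (simp add: mult_ac)
    then show ?case using ratio[of k] by linarith
  qed simp
  obtain K where K: "\<And>k. a k \<le> K * R ^ k"
    using ip_growth[of f] unfolding a_def sqnorm_def by blast
  have "\<rho> \<le> R"
  proof (rule ccontr)
    assume "\<not> \<rho> \<le> R"
    then have "1 < \<rho> / R" using R_pos by simp
    then obtain k where "K / a 0 < (\<rho> / R) ^ k"
      using real_arch_pow by blast
    then have "K * R ^ k < a 0 * \<rho> ^ k"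
      using a_pos[of 0] R_pos by (simp add: field_simps power_divide)
    then show False using geometric[of k] K[of k] by linarith
  qed
  then have "a 1 \<le> R * a 0"
    using a_pos[of 0] by (simp add: \<rho>_def field_simps)
  then show ?thesis by (simp add: a_def)
qed

text \<open>
  For a vector \<open>v\<close>, let \<open>V\<close> have all columns equal to \<open>v\<close>. The trace that is positive by assumption for
  \<open>mult_coeffs P V\<close> is then a multiple of the form at \<open>v\<close>. The polynomial is non-zero because its leading
  coefficient is \<open>V\<close>.
\<close>

lemma posdef_ip_monic:
  assumes "coeff P n = mat 1"
  shows "posdef (ip P P)"
  unfolding posdef_def
proof (intro conjI allI impI)
  show "hermitian (ip P P)"
    by (simp add: hermitian_def ip_adjoint)
  fix v :: "(complex, 'l) vec" assume v: "v \<noteq> 0"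
  define V :: "'l cmat" where "V = (\<chi> i j. v $ i)"
  have V: "V *v axis j 1 = v" for j
    by (simp add: vec_eq_iff matrix_mult_axis V_def)
  have "V \<noteq> 0"
    using v V by (metis matrix_vector_mult_0)
  then have "mult_coeffs P V \<noteq> 0"
    using assms by (metis coeff_0 coeff_mult_coeffs matrix_mul_lid)
  then have "0 < Re (trace (ip (mult_coeffs P V) (mult_coeffs P V)))"
    by (rule ip_trace_pos)
  also have "ip (mult_coeffs P V) (mult_coeffs P V) = hadjoint V ** (ip P P ** V)"
    by (simp add: ip_mult_left ip_mult_right matrix_mul_assoc)
  also have "Re (trace \<dots>) = CARD('l) * Re (cinner v (ip P P *v v))"
    unfolding trace_sandwich V by simp
  finally show "0 < Re (cinner v (ip P P *v v))"
    by (simp add: zero_less_mult_iff)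
qed

text \<open>
  Monic polynomials of degrees $0,\dots,n-1$ generate all polynomials of degree less than \<open>n\<close> as a right module
  over the matrices: subtract a multiple of the monic polynomial of highest degree and repeat.
\<close>

lemma ip_zero_if_orthogonal_to_basis:
  assumes P: "\<And>k. k < n \<Longrightarrow> degree (P k) = k \<and> coeff (P k) k = mat 1"
    and orth: "\<And>k. k < n \<Longrightarrow> ip Q (P k) = 0"
    and f: "degree f < n"
  shows "ip Q f = 0"
proof -
  have "\<forall>f. (\<forall>k\<ge>m. coeff f k = 0) \<longrightarrow> ip Q f = 0" if "m \<le> n" for m
    using that
  proof (induction m)
    case 0
    then show ?case by (metis coeff_0 ip_0_right poly_eqI zero_le)
  next
    case (Suc m)
    show ?case
    proof (intro allI impI)
      fix f :: "'l cmat poly" assume f: "\<forall>k\<ge>Suc m. coeff f k = 0"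
      define g where "g = f - mult_coeffs (P m) (coeff f m)"
      have "coeff g k = 0" if "k \<ge> m" for k
      proof (cases "k = m")
        case False
        then have "degree (P m) < k" using P[of m] Suc.prems that by simp
        then have "coeff (P m) k = 0" by (rule coeff_eq_0)
        then show ?thesis using f False that by (simp add: g_def)
      qed (use P[of m] Suc.prems in \<open>simp add: g_def\<close>)
      then have "ip Q g = 0" using Suc by simp
      then show "ip Q f = 0"
        using orth[of m] Suc.prems by (simp add: g_def ip_diff_right ip_mult_right)
    qed
  qed
  moreover have "\<forall>k\<ge>n. coeff f k = 0"
    using f by (auto intro: coeff_eq_0)
  ultimately show ?thesis by blast
qed

definition is_monic_orthogonal :: "nat \<Rightarrow> ('l::{finite,linorder}) cmat poly \<Rightarrow> bool" where
  "is_monic_orthogonal n P \<longleftrightarrow>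
     degree P = n \<and> coeff P n = mat 1 \<and> (\<forall>f. degree f < n \<longrightarrow> ip P f = 0)"

text \<open>
  Gram--Schmidt with matrix coefficients. The inverses exist by \<open>posdef_ip_monic\<close>.
\<close>

lemma monic_orthogonal_exists: "\<exists>P. is_monic_orthogonal n P"
proof (induction n rule: less_induct)
  case (less n)
  then obtain p where p: "\<And>k. k < n \<Longrightarrow> is_monic_orthogonal k (p k)"
    by metis
  define X :: "('l cmat) poly" where "X = monom (mat 1) n"
  define c where "c k = matrix_inv (ip (p k) (p k)) ** ip (p k) X" for k
  define Q where "Q = X - (\<Sum>k<n. mult_coeffs (p k) (c k))"
  have low: "coeff (p k) m = 0" if "k < n" "n \<le> m" for k m
    using p[of k] that by (auto simp: is_monic_orthogonal_def intro: coeff_eq_0)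
  have "coeff Q m = (if m = n then mat 1 else 0)" if "n \<le> m" for m
    using that low by (simp add: Q_def X_def coeff_sum)
  then have "coeff Q n = mat 1" "\<forall>m>n. coeff Q m = 0"
    by auto
  moreover have "mat 1 \<noteq> (0 :: 'l cmat)"
    by (auto simp: vec_eq_iff mat_def)
  ultimately have Q: "coeff Q n = mat 1" "degree Q = n"
    using degree_le[of n Q] le_degree[of Q n] by simp_all
  have "ip (p j) Q = 0" if "j < n" for j
  proof -
    have "ip (p j) (mult_coeffs (p k) (c k)) = (if k = j then ip (p j) X else 0)" if "k < n" for k
    proof (cases "k = j")
      case True
      have "invertible (ip (p j) (p j))"
        using p[OF \<open>j < n\<close>] posdef_ip_monic posdef_invertible
        unfolding is_monic_orthogonal_def by blast
      then show ?thesis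
        using True by (simp add: ip_mult_right c_def matrix_inv_cancel matrix_mul_assoc)
    next
      case False
      have "ip (p j) (p k) = 0"
      proof (cases "k < j")
        case True
        then show ?thesis using p[OF \<open>j < n\<close>] p[OF \<open>k < n\<close>] by (simp add: is_monic_orthogonal_def)
      next
        case False
        then have "ip (p k) (p j) = 0"
          using p[OF \<open>j < n\<close>] p[OF \<open>k < n\<close>] \<open>k \<noteq> j\<close> by (simp add: is_monic_orthogonal_def)
        then show ?thesis by (rule ip_zero_commute)
      qed
      then show ?thesis using False by (simp add: ip_mult_right)
    qed
    then have "(\<Sum>k<n. ip (p j) (mult_coeffs (p k) (c k))) = (\<Sum>k<n. if k = j then ip (p j) X else 0)"
      by (intro sum.cong) auto
    then show ?thesis
      using that by (simp add: Q_def ip_diff_right ip_sum_right)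
  qed
  then have "ip Q (p j) = 0" if "j < n" for j
    using that ip_zero_commute by blast
  then have "ip Q f = 0" if "degree f < n" for f
    using ip_zero_if_orthogonal_to_basis[of n p Q f] p that
    unfolding is_monic_orthogonal_def by blast
  then show ?case
    using Q by (auto simp: is_monic_orthogonal_def)
qed

text \<open>
  If it is not zero, the difference of two candidates has degree less than \<open>n\<close>, so it is orthogonal to both and
  hence to itself.
\<close>

lemma monic_orthogonal_unique:
  assumes P: "is_monic_orthogonal n P" and Q: "is_monic_orthogonal n Q"
  shows "P = Q"
proof (rule ccontr)
  assume "P \<noteq> Q"
  then have nz: "P - Q \<noteq> 0" by simp
  have "coeff (P - Q) k = 0" if "k \<ge> n" for k
    using P Q that unfolding is_monic_orthogonal_def
    by (cases "k = n") (auto simp: coeff_eq_0)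
  then have "degree (P - Q) < n"
    using nz by (metis leading_coeff_0_iff not_le)
  then have "ip (P - Q) (P - Q) = 0"
    using P Q by (simp add: is_monic_orthogonal_def ip_diff_left)
  then show False using ip_trace_pos[OF nz] by (simp add: trace_def)
qed

end

section \<open>The block Jacobi matrix of orthonormal polynomials\<close>

text \<open>
  The unitary factors \<open>\<sigma>\<close> are the freedom that is left in the choice of orthonormal polynomials once the monic
  ones are known.
\<close>

locale orthonormal_polynomials = matrix_inner_product ip R
  for ip :: "('l::{finite,linorder}) cmat poly \<Rightarrow> ('l::{finite,linorder}) cmat poly \<Rightarrow> ('l::{finite,linorder}) cmat" and R +
  fixes P :: "nat \<Rightarrow> ('l::{finite,linorder}) cmat poly"
    and \<sigma> :: "nat \<Rightarrow> ('l::{finite,linorder}) cmat"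
  assumes P: "is_monic_orthogonal n (P n)"
    and normalized: "ip [:mat 1:] [:mat 1:] = mat 1"
    and \<sigma>_unitary: "unitary (\<sigma> n)" and \<sigma>_0: "\<sigma> 0 = mat 1"
begin

definition "S n = pd_sqrt (ip (P n) (P n))"
definition "p n = mult_coeffs (P n) (inv_sqrt (ip (P n) (P n)) ** \<sigma> n)"
definition "jacobi n m = ip (p n) (pCons 0 (p m))"

lemma degree_P: "degree (P n) = n" and lead_P: "coeff (P n) n = mat 1"
  and orth_P: "degree f < n \<Longrightarrow> ip (P n) f = 0"
  using P[of n] by (simp_all add: is_monic_orthogonal_def)

lemma posdef_S: "posdef (S n)" and S_square: "S n ** S n = ip (P n) (P n)"
  unfolding S_def using pd_sqrt[OF posdef_ip_monic[OF lead_P]] by blast+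

lemma inv_sqrt_cancel:
  "matrix_inv (S n) ** S n = mat 1" "S n ** matrix_inv (S n) = mat 1"
  by (simp_all add: matrix_inv_cancel posdef_S posdef_invertible)

lemma hadjoint_inv_S: "hadjoint (matrix_inv (S n)) = matrix_inv (S n)"
  by (metis hadjoint_mat_1 hadjoint_mult inv_sqrt_cancel matrix_mul_assoc matrix_mul_lid
      matrix_mul_rid posdef_S posdef_adjoint)

lemma p_eq: "p n = mult_coeffs (P n) (matrix_inv (S n) ** \<sigma> n)"
  by (simp add: p_def S_def inv_sqrt_def)

lemma degree_p: "degree (p n) \<le> n"
  using degree_mult_coeffs[of "P n"] by (simp add: p_def degree_P)

lemma orth_p: "degree f < n \<Longrightarrow> ip (p n) f = 0"
  by (simp add: p_def ip_mult_left orth_P)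

lemma ip_p_p: "ip (p n) (p n) = mat 1"
proof -
  have "ip (p n) (p n) = hadjoint (\<sigma> n) ** (matrix_inv (S n) ** S n) ** (S n ** matrix_inv (S n)) ** \<sigma> n"
    by (simp add: p_eq ip_mult_left ip_mult_right hadjoint_mult hadjoint_inv_S S_square[symmetric]
        matrix_mul_assoc)
  then show ?thesis
    using \<sigma>_unitary[of n] by (simp add: inv_sqrt_cancel unitary_def)
qed

lemma jacobi_hadjoint: "hadjoint (jacobi n m) = jacobi m n"
  by (simp add: jacobi_def ip_adjoint ip_shift)

lemma jacobi_zero:
  assumes "Suc m < n"
  shows "jacobi n m = 0"
  unfolding jacobi_def
  by (rule orth_p) (use degree_p[of m] degree_pCons_le[of 0 "p m"] assms in linarith)

text \<open>
  Since \<open>P (Suc n)\<close> is orthogonal to all lower degrees, only the leading terms of \<open>pCons 0 (P n)\<close>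
  and \<open>P (Suc n)\<close> matter, and these agree.
\<close>

lemma jacobi_off_diagonal:
  "jacobi n (Suc n) = hadjoint (\<sigma> n) ** matrix_inv (S n) ** S (Suc n) ** \<sigma> (Suc n)"
proof -
  have "degree (pCons 0 (P n) - P (Suc n)) < Suc n"
  proof -
    have "coeff (pCons 0 (P n) - P (Suc n)) k = 0" if "k > n" for k
    proof (cases "k = Suc n")
      case False
      then show ?thesis using that by (simp add: coeff_eq_0 degree_P degree_pCons_eq_if coeff_pCons split: nat.split)
    qed (simp add: lead_P)
    then show ?thesis by (simp add: degree_le less_Suc_eq_le)
  qed
  then have "ip (P (Suc n)) (pCons 0 (P n) - P (Suc n)) = 0"
    by (rule orth_P)
  then have *: "ip (P (Suc n)) (pCons 0 (P n)) = S (Suc n) ** S (Suc n)"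
    by (simp add: ip_diff_right S_square)
  have "jacobi n (Suc n) = hadjoint (ip (p (Suc n)) (pCons 0 (p n)))"
    by (simp add: jacobi_def ip_adjoint ip_shift)
  also have "ip (p (Suc n)) (pCons 0 (p n)) = hadjoint (matrix_inv (S (Suc n)) ** \<sigma> (Suc n))
      ** (S (Suc n) ** S (Suc n)) ** (matrix_inv (S n) ** \<sigma> n)"
    unfolding p_eq mult_coeffs_pCons_0[symmetric]
    by (simp add: ip_mult_left ip_mult_right * matrix_mul_assoc)
  also have "\<dots> = hadjoint (\<sigma> (Suc n)) ** (matrix_inv (S (Suc n)) ** S (Suc n)) ** S (Suc n)
      ** (matrix_inv (S n) ** \<sigma> n)"
    by (simp add: hadjoint_mult hadjoint_inv_S matrix_mul_assoc)
  also have "hadjoint \<dots> = hadjoint (\<sigma> n) ** matrix_inv (S n) ** S (Suc n) ** \<sigma> (Suc n)"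
    by (simp add: inv_sqrt_cancel hadjoint_mult hadjoint_inv_S posdef_adjoint[OF posdef_S] matrix_mul_assoc)
  finally show ?thesis .
qed

lemma S_0: "S 0 = mat 1"
proof -
  have "P 0 = [:mat 1:]"
    using degree_P[of 0] lead_P[of 0] by (metis coeff_pCons_0 degree_0_id)
  then have "S 0 ** S 0 = mat 1 ** mat 1"
    by (simp add: S_square normalized)
  then show ?thesis
    by (rule posdef_sqrt_unique[OF posdef_S posdef_mat_1])
qed

lemma mat_prod_jacobi: "mat_prod (\<lambda>k. jacobi k (Suc k)) n = S n ** \<sigma> n"
proof (induction n)
  case 0
  show ?case by (simp add: S_0 \<sigma>_0)
next
  case (Suc n)
  have "mat_prod (\<lambda>k. jacobi k (Suc k)) (Suc n)
      = S n ** (\<sigma> n ** hadjoint (\<sigma> n)) ** matrix_inv (S n) ** S (Suc n) ** \<sigma> (Suc n)"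
    by (simp add: Suc matrix_mul_assoc) (simp add: jacobi_off_diagonal matrix_mul_assoc)
  then show ?case
    using \<sigma>_unitary[of n] by (simp add: unitary_def inv_sqrt_cancel)
qed

lemma type2_jacobi_iff: "type2 jacobi \<longleftrightarrow> (\<forall>n. \<sigma> n = mat 1)"
proof
  assume type2: "type2 jacobi"
  show "\<forall>n. \<sigma> n = mat 1"
  proof
    fix n
    show "\<sigma> n = mat 1"
    proof (cases "n = 0")
      case False
      then have "posdef (S n ** \<sigma> n)"
        using type2 by (simp add: type2_def mat_prod_jacobi)
      moreover have "posdef (S n ** mat 1)"
        by (simp add: posdef_S)
      ultimately show ?thesis
        using polar_ex1[OF posdef_invertible[OF posdef_S[of n]]] \<sigma>_unitary unitary_mat_1 by blast
    qed (simp add: \<sigma>_0)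
  qed
qed (simp add: type2_def mat_prod_jacobi posdef_S)

text \<open>
  The squared norm of a block \<open>J\<close> is the trace of the inner product of \<open>mult_coeffs (p n) J\<close>,
  whose norm is that of \<open>J\<close>, with \<open>pCons 0 (p m)\<close>, whose norm is controlled by \<open>shift_bounded\<close>.
\<close>

lemma norm_jacobi_le: "(norm (jacobi n m))\<^sup>2 \<le> R * CARD('l)"
proof -
  define J where "J = jacobi n m"
  define f where "f = mult_coeffs (p n) J"
  have "trace (ip f (pCons 0 (p m))) = of_real ((norm J)\<^sup>2)"
    by (simp only: f_def ip_mult_left jacobi_def[symmetric] J_def[symmetric] trace_adjoint_mult)
  moreover have "sqnorm f = (norm J)\<^sup>2"
    by (simp only: sqnorm_def f_def ip_mult_left ip_mult_right ip_p_p matrix_mul_rid trace_adjoint_mult Re_complex_of_real)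
  ultimately have "((norm J)\<^sup>2)\<^sup>2 \<le> (norm J)\<^sup>2 * sqnorm (pCons 0 (p m))"
    using trace_ip_Cauchy_Schwarz[of f "pCons 0 (p m)"] by (metis Re_complex_of_real)
  then have "(norm J)\<^sup>2 * (norm J)\<^sup>2 \<le> (norm J)\<^sup>2 * sqnorm (pCons 0 (p m))"
    by (simp only: power2_eq_square)
  then have "(norm J)\<^sup>2 \<le> sqnorm (pCons 0 (p m)) \<or> J = 0"
    by (simp only: mult_le_cancel_left) (auto simp: less_le)
  moreover have "sqnorm (pCons 0 (p m)) \<le> R * CARD('l)"
    using shift_bounded[of "p m"] by (simp add: sqnorm_def ip_p_p trace_I)
  ultimately show ?thesis
    using R_pos by (auto simp: J_def[symmetric])
qed

lemma jacobi_block_jacobi: "jacobi \<in> block_jacobi"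
proof -
  define A where "A n = jacobi n (Suc n)" for n
  define B where "B n = jacobi n n" for n
  have "jacobi n m = jacobi_blocks A B n m" for n m
  proof -
    consider "m = n" | "m = Suc n" | "n = Suc m" | "Suc m < n" | "Suc n < m"
      by linarith
    then show ?thesis
    proof cases
      case 5
      then have "jacobi n m = hadjoint 0"
        by (metis jacobi_hadjoint jacobi_zero)
      then show ?thesis using 5 by (simp add: jacobi_blocks_def)
    qed (auto simp: jacobi_blocks_def A_def B_def jacobi_hadjoint jacobi_zero)
  qed
  then have "jacobi = jacobi_blocks A B"
    by (simp add: fun_eq_iff)
  moreover have "hermitian (B n)" for n
    by (simp add: hermitian_def B_def jacobi_hadjoint)
  moreover have "det (A n) \<noteq> 0" for n
  proof -
    have "invertible (matrix_inv (S n))"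
      using inv_sqrt_cancel unfolding invertible_def by blast
    then show ?thesis
      unfolding det_nonzero_iff_invertible A_def jacobi_off_diagonal
      by (intro invertible_mult posdef_invertible[OF posdef_S] unitary_invertible[OF \<sigma>_unitary]
          unitary_invertible[OF unitary_hadjoint[OF \<sigma>_unitary]])
  qed
  moreover have "bdd_above (range (\<lambda>n. norm (A n) + norm (B n)))"
  proof (rule bdd_aboveI2)
    fix n
    have "norm (jacobi n m) \<le> sqrt (R * CARD('l))" for m
      by (rule real_le_rsqrt[OF norm_jacobi_le])
    then show "norm (A n) + norm (B n) \<le> sqrt (R * CARD('l)) + sqrt (R * CARD('l))"
      unfolding A_def B_def by (intro add_mono)
  qed
  ultimately show ?thesis
    unfolding block_jacobi_def by blast
qed

end

section \<open>Evaluation of matrix polynomials\<close>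

lemma mpoly_eval_upto:
  assumes "degree f \<le> N"
  shows "mpoly_eval f x = (\<Sum>k\<le>N. x ^ k *\<^sub>R coeff f k)"
  unfolding mpoly_eval_def
  by (intro sum.mono_neutral_left) (use assms in \<open>auto simp: coeff_eq_0\<close>)

lemma mpoly_eval_add: "mpoly_eval (f + g) x = mpoly_eval f x + mpoly_eval g x"
proof -
  define N where "N = max (degree f) (degree g)"
  have "degree (f + g) \<le> N" "degree f \<le> N" "degree g \<le> N"
    by (auto simp: N_def degree_add_le_max)
  then show ?thesis
    by (simp add: mpoly_eval_upto[where N = N] scaleR_add_right sum.distrib)
qed

lemma mpoly_eval_mult_coeffs: "mpoly_eval (mult_coeffs f C) x = mpoly_eval f x ** C"
  for f :: "(complex^'l^'l) poly"
proof -
  have "(\<Sum>k\<in>S. a k *\<^sub>R A k) ** C = (\<Sum>k\<in>S. a k *\<^sub>R (A k ** C))" for a :: "nat \<Rightarrow> real" and A :: "nat \<Rightarrow> complex^'l^'l" and S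
    by (induction S rule: infinite_finite_induct)
      (auto simp: vec_eq_iff matrix_matrix_mult_def algebra_simps sum.distrib scaleR_sum_right)
  then show ?thesis
    by (simp add: mpoly_eval_upto[OF degree_mult_coeffs[of f C]] mpoly_eval_def[of f])
qed

lemma mpoly_eval_pCons_0: "mpoly_eval (pCons 0 f) x = x *\<^sub>R mpoly_eval f x"
proof -
  have "degree (pCons 0 f) \<le> Suc (degree f)"
    by (rule degree_pCons_le)
  then have "mpoly_eval (pCons 0 f) x = (\<Sum>k\<le>Suc (degree f). x ^ k *\<^sub>R coeff (pCons 0 f) k)"
    by (rule mpoly_eval_upto)
  also have "\<dots> = (\<Sum>k\<le>degree f. x ^ Suc k *\<^sub>R coeff f k)"
    by (subst sum.atMost_Suc_shift) simp
  finally show ?thesis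
    by (simp add: mpoly_eval_def scaleR_sum_right)
qed

lemma mpoly_eval_shift_power: "mpoly_eval ((pCons 0 ^^ k) f) x = x ^ k *\<^sub>R mpoly_eval f x"
  by (induction k) (simp_all add: mpoly_eval_pCons_0)

lemma continuous_mpoly_eval [continuous_intros]:
  "continuous_on S (\<lambda>x. mpoly_eval f x $ i $ j)"
  unfolding mpoly_eval_def by (simp, intro continuous_intros)

section \<open>Integration against a compactly supported matrix-valued measure\<close>

text \<open>
  For the adjoint of an integral the two polarization vectors have to be exchanged. Up to a phase,
  \<open>polar_vec b a k\<close> is \<open>polar_vec a b k\<close> with \<open>k\<close> replaced by \<open>- k\<close> modulo 4.
\<close>

lemma quad_measure_phase:
  assumes "cmod c = 1"
  shows "quad_measure \<mu> (c *s v) = quad_measure \<mu> v"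
proof -
  have "cnj c * c = 1"
    using assms complex_norm_square[of c] by (simp add: mult.commute)
  then have "cinner (c *s v) (A *v (c *s v)) = cinner v (A *v v)" for A :: "complex^'a^'a"
    by (simp add: vector_scalar_commute cinner_scale_left cinner_scale_right mult.assoc[symmetric] mult.commute)
  then show ?thesis by (simp add: quad_measure_def)
qed

lemma sum_four: "(\<Sum>k<4. f k) = f 0 + f 1 + f 2 + f (3::nat)" for f :: "nat \<Rightarrow> 'a::comm_monoid_add"
  by (simp add: numeral_eq_Suc lessThan_Suc algebra_simps)

lemma cnj_entry_integral: "cnj (entry_integral \<mu> a b h) = entry_integral \<mu> b a (\<lambda>x. cnj (h x))"
proof -
  have "polar_vec b a 0 = polar_vec a b 0"
    "polar_vec b a 1 = \<i> *s polar_vec a b 3"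
    "polar_vec b a 2 = (-1) *s polar_vec a b 2"
    "polar_vec b a 3 = (-\<i>) *s polar_vec a b 1"
    by (simp_all add: polar_vec_def vec_eq_iff algebra_simps power3_eq_cube)
  then have q: "quad_measure \<mu> (polar_vec b a 0) = quad_measure \<mu> (polar_vec a b 0)"
    "quad_measure \<mu> (polar_vec b a 1) = quad_measure \<mu> (polar_vec a b 3)"
    "quad_measure \<mu> (polar_vec b a 2) = quad_measure \<mu> (polar_vec a b 2)"
    "quad_measure \<mu> (polar_vec b a 3) = quad_measure \<mu> (polar_vec a b 1)"
    by (simp_all only: quad_measure_phase norm_ii norm_minus_cancel norm_one)
  show ?thesis
    unfolding entry_integral_def sum_four q
    by (simp add: power3_eq_cube)
qed

locale compact_matrix_measure =
  fixes \<mu> :: "real set \<Rightarrow> complex^'l^'l"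
  assumes matrix_measure: "matrix_measure \<mu>" and compact_support: "compact (mm_support \<mu>)"
begin

lemma finite_quad_measure: "finite_measure (quad_measure \<mu> v)"
  by (rule finite_measureI) (simp add: emeasure_quad_measure[OF matrix_measure])

text \<open>
  The complement of the support is a union of open null sets. By second countability, countably many of
  them suffice.
\<close>

lemma AE_mm_support: "AE x in quad_measure \<mu> v. x \<in> mm_support \<mu>"
proof -
  define F where "F = {U. open U \<and> \<mu> U = 0}"
  have "open U" if "U \<in> F" for U using that by (simp add: F_def)
  then obtain F' where F': "F' \<subseteq> F" "countable F'" "\<Union>F' = \<Union>F"
    by (rule Lindelof)
  have "(\<Union>U\<in>F'. U) \<in> null_sets (quad_measure \<mu> v)"
  proof (rule null_sets_UN'[OF F'(2)])
    fix U assume "U \<in> F'"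
    then have "open U" "\<mu> U = 0" using F' by (auto simp: F_def)
    then show "U \<in> null_sets (quad_measure \<mu> v)"
      by (simp add: null_sets_def emeasure_quad_measure[OF matrix_measure] cinner_def)
  qed
  moreover have "{x \<in> space (quad_measure \<mu> v). x \<notin> mm_support \<mu>} \<subseteq> (\<Union>U\<in>F'. U)"
    using F'(3) by (auto simp: F_def mm_support_def)
  ultimately show ?thesis by (rule AE_I')
qed

lemma support_radius: obtains r where "r > 0" "\<And>v. AE x in quad_measure \<mu> v. \<bar>x\<bar> \<le> r"
proof -
  obtain r where "r > 0" "\<forall>x\<in>mm_support \<mu>. norm x \<le> r"
    using compact_imp_bounded[OF compact_support] unfolding bounded_pos by blast
  then have "AE x in quad_measure \<mu> v. \<bar>x\<bar> \<le> r" for v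
    using AE_mm_support[of v] by (auto elim: AE_mp)
  then show ?thesis using that \<open>r > 0\<close> by blast
qed

lemma integrable_continuous:
  fixes h :: "real \<Rightarrow> complex"
  assumes h: "continuous_on UNIV h"
  shows "integrable (quad_measure \<mu> v) h"
proof -
  interpret finite_measure "quad_measure \<mu> v" by (rule finite_quad_measure)
  obtain r where r: "AE x in quad_measure \<mu> v. \<bar>x\<bar> \<le> r"
    using support_radius by blast
  have "compact (h ` {-r..r})"
    by (intro compact_continuous_image continuous_on_subset[OF h]) auto
  then obtain B where "\<forall>z\<in>h ` {-r..r}. norm z \<le> B"
    using compact_imp_bounded bounded_iff by metis
  then have "AE x in quad_measure \<mu> v. norm (h x) \<le> B"
    using r by (auto elim!: AE_mp simp: abs_le_iff)
  moreover have "h \<in> borel_measurable (quad_measure \<mu> v)"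
    using borel_measurable_continuous_onI[OF h] by (simp cong: measurable_cong_sets)
  ultimately show ?thesis by (rule integrable_const_bound)
qed

lemma entry_integral_add:
  assumes "continuous_on UNIV g" "continuous_on UNIV h"
  shows "entry_integral \<mu> a b (\<lambda>x. g x + h x) = entry_integral \<mu> a b g + entry_integral \<mu> a b h"
  by (simp add: entry_integral_def integrable_continuous assms Bochner_Integration.integral_add
      ring_distribs sum.distrib add_divide_distrib)

lemma entry_integral_mult: "entry_integral \<mu> a b (\<lambda>x. h x * c) = entry_integral \<mu> a b h * c"
  by (simp add: entry_integral_def sum_distrib_right mult.assoc)

lemma entry_integral_0 [simp]: "entry_integral \<mu> a b (\<lambda>x. 0) = 0"
  by (simp add: entry_integral_def)

lemma entry_integral_sum:
  assumes "\<And>k. k \<in> S \<Longrightarrow> continuous_on UNIV (h k)"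
  shows "entry_integral \<mu> a b (\<lambda>x. \<Sum>k\<in>S. h k x) = (\<Sum>k\<in>S. entry_integral \<mu> a b (h k))"
  using assms
  by (induction S rule: infinite_finite_induct) (auto simp: entry_integral_add continuous_on_sum)

text \<open>
  Each of the four scalar measures of the polarization lives on $[-r,r]$, where $|x^k h| \le r^k |h|$. This is how
  compactness of the support enters the bound on the blocks.
\<close>

lemma entry_integral_growth:
  assumes r: "r > 0" "\<And>v. AE x in quad_measure \<mu> v. \<bar>x\<bar> \<le> r" and h: "continuous_on UNIV h"
  shows "\<exists>K. \<forall>k. cmod (entry_integral \<mu> a b (\<lambda>x. of_real (x ^ k) * h x)) \<le> K * r ^ k"
proof -
  define I where "I v = (LINT x|quad_measure \<mu> v. cmod (h x))" for v
  have int: "cmod (LINT x|quad_measure \<mu> v. of_real (x ^ k) * h x) \<le> r ^ k * I v" for v k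
  proof -
    have "cmod (LINT x|quad_measure \<mu> v. of_real (x ^ k) * h x)
        \<le> (LINT x|quad_measure \<mu> v. cmod (of_real (x ^ k) * h x))"
      by (rule integral_norm_bound)
    also have "\<dots> \<le> (LINT x|quad_measure \<mu> v. r ^ k * cmod (h x))"
    proof (rule integral_mono_AE)
      show "integrable (quad_measure \<mu> v) (\<lambda>x. cmod (of_real (x ^ k) * h x))"
        by (intro integrable_norm integrable_continuous continuous_intros h)
      show "integrable (quad_measure \<mu> v) (\<lambda>x. r ^ k * cmod (h x))"
        by (intro integrable_mult_right integrable_norm integrable_continuous h)
      have "cmod (of_real (x ^ k) * h x) \<le> r ^ k * cmod (h x)" if "\<bar>x\<bar> \<le> r" for x
        using that by (simp add: norm_mult norm_power mult_right_mono power_mono)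
      then show "AE x in quad_measure \<mu> v. cmod (of_real (x ^ k) * h x) \<le> r ^ k * cmod (h x)"
        using r(2)[of v] by (auto elim!: AE_mp)
    qed
    finally show ?thesis by (simp add: I_def)
  qed
  have "cmod (entry_integral \<mu> a b (\<lambda>x. of_real (x ^ k) * h x)) \<le> (\<Sum>j<4. I (polar_vec a b j)) / 4 * r ^ k" for k
  proof -
    have "cmod (\<Sum>j<4. (- \<i>) ^ j * (LINT x|quad_measure \<mu> (polar_vec a b j). of_real (x ^ k) * h x))
        \<le> (\<Sum>j<4. r ^ k * I (polar_vec a b j))"
      by (rule sum_norm_le) (simp add: norm_mult norm_power int del: of_real_power)
    then show ?thesis
      by (simp add: entry_integral_def norm_divide sum_distrib_left[symmetric] mult.commute del: of_real_power)
  qed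
  then show ?thesis by blast
qed

lemma mp_inner_entry: "mp_inner \<mu> f g $ i $ j = (\<Sum>a\<in>UNIV. \<Sum>b\<in>UNIV.
     entry_integral \<mu> a b (\<lambda>x. cnj (mpoly_eval f x $ a $ i) * mpoly_eval g x $ b $ j))"
  by (simp add: mp_inner_def mm_inner_def)

lemma mp_inner_add_right: "mp_inner \<mu> f (g + h) = mp_inner \<mu> f g + mp_inner \<mu> f h"
  by (simp add: vec_eq_iff mp_inner_entry mpoly_eval_add distrib_left entry_integral_add
      continuous_intros sum.distrib)

lemma mp_inner_mult_right: "mp_inner \<mu> f (mult_coeffs g C) = mp_inner \<mu> f g ** C"
proof -
  have "entry_integral \<mu> a b (\<lambda>x. cnj (mpoly_eval f x $ a $ i) * mpoly_eval (mult_coeffs g C) x $ b $ j)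
      = (\<Sum>c\<in>UNIV. entry_integral \<mu> a b (\<lambda>x. cnj (mpoly_eval f x $ a $ i) * mpoly_eval g x $ b $ c) * C $ c $ j)"
    for a b i j
  proof -
    have "cnj (mpoly_eval f x $ a $ i) * mpoly_eval (mult_coeffs g C) x $ b $ j
        = (\<Sum>c\<in>UNIV. cnj (mpoly_eval f x $ a $ i) * mpoly_eval g x $ b $ c * C $ c $ j)" for x
      by (simp add: mpoly_eval_mult_coeffs matrix_matrix_mult_def sum_distrib_left mult.assoc)
    then show ?thesis
      by (simp add: entry_integral_sum continuous_intros entry_integral_mult)
  qed
  moreover have "(\<Sum>a\<in>UNIV. \<Sum>b\<in>UNIV. \<Sum>c\<in>UNIV. F a b c) = (\<Sum>c\<in>UNIV. \<Sum>a\<in>UNIV. \<Sum>b\<in>UNIV. F a b c)"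
    for F :: "'l \<Rightarrow> 'l \<Rightarrow> 'l \<Rightarrow> complex"
  proof -
    have "(\<Sum>a\<in>UNIV. \<Sum>b\<in>UNIV. \<Sum>c\<in>UNIV. F a b c) = (\<Sum>a\<in>UNIV. \<Sum>c\<in>UNIV. \<Sum>b\<in>UNIV. F a b c)"
      by (intro sum.cong refl sum.swap)
    also have "\<dots> = (\<Sum>c\<in>UNIV. \<Sum>a\<in>UNIV. \<Sum>b\<in>UNIV. F a b c)"
      by (rule sum.swap)
    finally show ?thesis .
  qed
  ultimately show ?thesis
    by (simp add: vec_eq_iff matrix_matrix_mult_def mp_inner_entry sum_distrib_right)
qed

lemma hadjoint_mp_inner: "hadjoint (mp_inner \<mu> f g) = mp_inner \<mu> g f"
proof -
  have "hadjoint (mp_inner \<mu> f g) $ i $ j = (\<Sum>a\<in>UNIV. \<Sum>b\<in>UNIV.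
      entry_integral \<mu> b a (\<lambda>x. cnj (mpoly_eval g x $ b $ i) * mpoly_eval f x $ a $ j))" for i j
    by (simp add: mp_inner_entry cnj_entry_integral mult.commute)
  then show ?thesis
    by (simp add: vec_eq_iff mp_inner_entry) (intro allI sum.swap)
qed

lemma mp_inner_shift: "mp_inner \<mu> (pCons 0 f) g = mp_inner \<mu> f (pCons 0 g)"
  by (simp add: vec_eq_iff mp_inner_entry mpoly_eval_pCons_0)

lemma mp_inner_growth:
  assumes r: "r > 0" "\<And>v. AE x in quad_measure \<mu> v. \<bar>x\<bar> \<le> r"
  shows "\<exists>K. \<forall>k. Re (trace (mp_inner \<mu> ((pCons 0 ^^ k) f) ((pCons 0 ^^ k) f))) \<le> K * (r\<^sup>2) ^ k"
proof -
  define h where "h i a b x = cnj (mpoly_eval f x $ a $ i) * mpoly_eval f x $ b $ i" for i a b x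
  define K where "K i a b = (SOME C. \<forall>k. cmod (entry_integral \<mu> a b (\<lambda>x. of_real (x ^ k) * h i a b x)) \<le> C * r ^ k)"
    for i a b
  have "\<exists>C. \<forall>k. cmod (entry_integral \<mu> a b (\<lambda>x. of_real (x ^ k) * h i a b x)) \<le> C * r ^ k" for i a b
    unfolding h_def by (intro entry_integral_growth r continuous_intros)
  from someI_ex[OF this]
  have K: "cmod (entry_integral \<mu> a b (\<lambda>x. of_real (x ^ k) * h i a b x)) \<le> K i a b * r ^ k" for i a b k
    unfolding K_def by blast
  have "Re (trace (mp_inner \<mu> ((pCons 0 ^^ k) f) ((pCons 0 ^^ k) f)))
      \<le> (\<Sum>i\<in>UNIV. \<Sum>a\<in>UNIV. \<Sum>b\<in>UNIV. K i a b) * (r\<^sup>2) ^ k" for k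
  proof -
    have "trace (mp_inner \<mu> ((pCons 0 ^^ k) f) ((pCons 0 ^^ k) f)) = (\<Sum>i\<in>UNIV. \<Sum>a\<in>UNIV. \<Sum>b\<in>UNIV.
        entry_integral \<mu> a b (\<lambda>x. of_real (x ^ (2 * k)) * h i a b x))"
    proof -
      have "cnj ((x ^ k *\<^sub>R mpoly_eval f x) $ a $ i) * (x ^ k *\<^sub>R mpoly_eval f x) $ b $ i
          = of_real (x ^ (2 * k)) * h i a b x" for x i a b
        unfolding vector_scaleR_component by (simp add: h_def scaleR_conv_of_real mult_2 power_add)
      then show ?thesis
        unfolding trace_def mp_inner_entry mpoly_eval_shift_power by (simp only:)
    qed
    then have "Re (trace (mp_inner \<mu> ((pCons 0 ^^ k) f) ((pCons 0 ^^ k) f)))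
        \<le> (\<Sum>i\<in>UNIV. \<Sum>a\<in>UNIV. \<Sum>b\<in>UNIV. K i a b * r ^ (2 * k))"
      by (simp only: Re_sum) (intro sum_mono order_trans[OF complex_Re_le_cmod K])
    then show ?thesis
      by (simp add: sum_distrib_right power_mult)
  qed
  then show ?thesis by blast
qed

lemma mp_inner_mat_1: "mp_inner \<mu> [:mat 1:] [:mat 1:] = \<mu> UNIV"
proof -
  have "(\<Sum>a\<in>UNIV. \<Sum>b\<in>UNIV. entry_integral \<mu> a b (\<lambda>x. cnj (mat 1 $ a $ i) * mat 1 $ b $ j)) = \<mu> UNIV $ i $ j" for i j
  proof -
    have "entry_integral \<mu> a b (\<lambda>x. cnj (mat 1 $ a $ i) * mat 1 $ b $ j)
        = (if b = j then if a = i then \<mu> UNIV $ a $ b else 0 else 0)" for a b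
      using entry_integral_indicator[OF matrix_measure, of UNIV a b]
      by (auto simp: mat_def indicator_def)
    then show ?thesis by simp
  qed
  then show ?thesis
    by (simp add: vec_eq_iff mp_inner_entry mpoly_eval_def)
qed

end

section \<open>The block Jacobi matrix of a measure\<close>

lemma op_jacobi_eq:
  "op_jacobi \<mu> \<sigma> n m = mp_inner \<mu>
     (mult_coeffs (monic_orth_poly \<mu> n)
       (inv_sqrt (mp_inner \<mu> (monic_orth_poly \<mu> n) (monic_orth_poly \<mu> n)) ** \<sigma> n))
     (pCons 0 (mult_coeffs (monic_orth_poly \<mu> m)
       (inv_sqrt (mp_inner \<mu> (monic_orth_poly \<mu> m) (monic_orth_poly \<mu> m)) ** \<sigma> m)))"
  unfolding op_jacobi_def orthonormal_poly_def mp_inner_def[of _ "mult_coeffs _ _"]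
  by (intro arg_cong2[where f = "mm_inner \<mu>"] ext)
    (simp_all add: mpoly_eval_pCons_0 mpoly_eval_mult_coeffs matrix_mul_assoc)

lemma op_jacobi_normalization:
  fixes \<mu> :: "real set \<Rightarrow> complex^('l::{finite,linorder})^('l::{finite,linorder})"
  assumes "matrix_measure \<mu>" "compact (mm_support \<mu>)" "\<mu> UNIV = mat 1" "nontrivial_mm \<mu>"
    and "\<And>n. unitary (\<sigma> n)" "\<sigma> 0 = mat 1"
  shows "op_jacobi \<mu> \<sigma> \<in> block_jacobi" "type2 (op_jacobi \<mu> \<sigma>) \<longleftrightarrow> (\<forall>n. \<sigma> n = mat 1)"
proof -
  interpret M: compact_matrix_measure \<mu>
    using assms by unfold_locales
  obtain r where r: "r > 0" "\<And>v. AE x in quad_measure \<mu> v. \<bar>x\<bar> \<le> r"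
    using M.support_radius by blast
  interpret I: matrix_inner_product "mp_inner \<mu>" "r\<^sup>2"
  proof
    show "f \<noteq> 0 \<Longrightarrow> 0 < Re (trace (mp_inner \<mu> f f))" for f
      using assms(4) by (simp add: nontrivial_mm_def)
    show "0 < r\<^sup>2" using r(1) by simp
  qed (fact M.mp_inner_add_right M.mp_inner_mult_right M.hadjoint_mp_inner M.mp_inner_shift
      M.mp_inner_growth[OF r])+
  have "\<exists>!P. I.is_monic_orthogonal n P" for n
    using I.monic_orthogonal_exists I.monic_orthogonal_unique by blast
  then have monic: "I.is_monic_orthogonal n (monic_orth_poly \<mu> n)" for n
    unfolding monic_orth_poly_def I.is_monic_orthogonal_def[abs_def] by (rule theI')
  interpret O: orthonormal_polynomials "mp_inner \<mu>" "r\<^sup>2" "monic_orth_poly \<mu>" \<sigma>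
    using monic M.mp_inner_mat_1 assms by unfold_locales simp_all
  have "op_jacobi \<mu> \<sigma> = O.jacobi"
    by (simp add: fun_eq_iff op_jacobi_eq O.jacobi_def O.p_def)
  then show "op_jacobi \<mu> \<sigma> \<in> block_jacobi" "type2 (op_jacobi \<mu> \<sigma>) \<longleftrightarrow> (\<forall>n. \<sigma> n = mat 1)"
    using O.jacobi_block_jacobi O.type2_jacobi_iff by simp_all
qed

theorem theorem2p8:
  shows "(\<forall>C \<in> (block_jacobi :: ('l::{finite,linorder}) block_matrix set) // block_jacobi_equiv.
            (\<exists>!J. J \<in> C \<and> type1 J) \<and> (\<exists>!J. J \<in> C \<and> type2 J) \<and> (\<exists>!J. J \<in> C \<and> type3 J))
    \<and> (\<forall>(\<mu> :: real set \<Rightarrow> complex^('l::{finite,linorder})^('l::{finite,linorder})) \<sigma>.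
          matrix_measure \<mu> \<and> compact (mm_support \<mu>) \<and> \<mu> UNIV = mat 1 \<and> nontrivial_mm \<mu>
          \<and> (\<forall>n. unitary (\<sigma> n)) \<and> \<sigma> 0 = mat 1 \<longrightarrow>
          op_jacobi \<mu> \<sigma> \<in> block_jacobi \<and>
          (type2 (op_jacobi \<mu> \<sigma>) \<longleftrightarrow> (\<forall>n. \<sigma> n = mat 1)))"
  using equivalence_class_normal_forms op_jacobi_normalization by blast

end
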